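(* (i) Let $S\equiv\pm\{1, 6, 7, 8, 9, 11, 12, 13, 16, 17, 19, 23\}\pmod{50}$ and $T\equiv\pm\{1, 5, 6, 7, 8, 11, 15, 17, 18, 19, 23, 24\}\pmod{50}$. Then $p(S,n)=p(T,n-1)$ for all $n\geq 1$. (ii) Let $S\equiv\pm\{1, 3, 4, 5, 7, 15, 17, 18, 19, 21, 22, 24\}\pmod{50}$ and $T\equiv\pm\{1, 2, 3, 7, 11, 14, 17, 18, 19, 21, 23, 24\}\pmod{50}$. Then $p(S,n)=p(T,n-1)$ for all $n\geq 1$. (iii) Let $S\equiv\pm\{1, 3, 4, 5, 7, 9, 12, 13, 15, 16, 21, 22\}\pmod{50}$ and $T\equiv\pm\{1, 3, 4, 6, 7, 8, 9, 13, 17, 19, 21, 22\}\pmod{50}$. Then $p(S,n)=p(T,n)$ for all integers $n\ge0$ with $n\neq 5$. (iv) Let $S\equiv\pm\{2, 3, 5, 9, 11, 12, 13, 14, 15, 16, 21, 23\}\pmod{50}$ and $T\equiv\pm\{1, 3, 7, 9, 11, 12, 13, 16, 18, 21, 23, 24\}\pmod{50}$. Then $p(S,n)=p(T,n-2)$ for all $n\geq 2$. (v) Let $S\equiv\pm\{2, 5, 6, 8, 9, 11, 13, 14, 15, 17, 19, 23\}\pmod{50}$ and $T\equiv\pm\{2, 3, 4, 9, 11, 13, 14, 17, 19, 21, 22, 23\}\pmod{50}$. Then $p(S,n)=p(T,n-2)$ for all $n\geq 2$.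
   Context: For a set $S$ of positive integers and an integer $n\ge 0$, $p(S,n)$ denotes the number of partitions of $n$ into parts belonging to $S$ (so $p(S,0)=1$). The notation $S\equiv\pm\{r_1,\dots,r_k\}\pmod M$ means that $S$ is the set of all positive integers $n$ such that $n\equiv r_i$ or $n\equiv -r_i\pmod M$ for some $i$. *)

theory Defs
  imports "HOL-Library.Multiset" "HOL-Number_Theory.Cong"
begin

definition num_partitions :: "nat set \<Rightarrow> nat \<Rightarrow> nat" where
  "num_partitions S n = card {P :: nat multiset. set_mset P \<subseteq> S \<and> sum_mset P = n}"

definition pm_residue_class :: "int set \<Rightarrow> int \<Rightarrow> nat set" where
  "pm_residue_class R M =
     {n. n > 0 \<and> (\<exists>r\<in>R. [int n = r] (mod M) \<or> [int n = - r] (mod M))}"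

text \<open>Since \<^const>\<open>card\<close> is 0 on infinite sets, \<^const>\<open>num_partitions\<close> is only meaningful
  when the set of partitions is finite, which holds for sets of positive parts.\<close>

lemma finite_partitions:
  assumes "0 \<notin> S"
  shows "finite {P :: nat multiset. set_mset P \<subseteq> S \<and> sum_mset P = n}"
proof (rule finite_subset)
  show "{P :: nat multiset. set_mset P \<subseteq> S \<and> sum_mset P = n}
      \<subseteq> mset ` {xs. set xs \<subseteq> {..n} \<and> length xs \<le> n}"
  proof
    fix P :: "nat multiset"
    assume P: "P \<in> {P. set_mset P \<subseteq> S \<and> sum_mset P = n}"
    obtain xs where xs: "P = mset xs" using ex_mset by metis
    have sum: "sum_list xs = n" using P xs by (simp add: sum_mset_sum_list)
    have "length ys \<le> sum_list ys" if "0 \<notin> set ys" for ys :: "nat list"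
      using that by (induction ys) auto
    moreover have "0 \<notin> set xs" using P xs assms by auto
    ultimately have "length xs \<le> n" using sum by blast
    moreover have "set xs \<subseteq> {..n}" using sum member_le_sum_list by fastforce
    ultimately show "P \<in> mset ` {xs. set xs \<subseteq> {..n} \<and> length xs \<le> n}" using xs by blast
  qed
  show "finite (mset ` {xs. set xs \<subseteq> {..n} \<and> length xs \<le> n})"
    by (intro finite_imageI finite_lists_length_le) simp
qed

lemma zero_notin_pm_residue_class: "0 \<notin> pm_residue_class R M"
  by (simp add: pm_residue_class_def)

end

theory Submission
  imports
    Defs
    "HOL-Analysis.Infinite_Sum"
    "HOL-Analysis.Infinite_Products"
    "HOL-Library.Nat_Bijection"
begin

text \<open>
  Write \<open>E r\<close> for the generalised Dedekind eta function \<open>gen_eta q 50 r\<close>: a power of \<open>q\<close> times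
  the product of \<open>1 - q ^ m\<close> over the \<open>m > 0\<close> congruent to \<open>r\<close> or \<open>- r\<close> modulo 50. The
  generating function of the \<open>p(S, n)\<close> is, up to a power of \<open>q\<close>, the reciprocal of the product
  \<open>E_S\<close> of the \<open>E r\<close> over the residues \<open>r\<close> that define \<open>S\<close>. Each claim says that
  \<open>1 / E_S = 1 / E_T + 1\<close>; the powers of \<open>q\<close> account for the shifts and for the exceptional values
  of \<open>n\<close>. Claim (i) is the relation
  \<open>E 5 E 15 E 18 E 24 - E 9 E 12 E 13 E 16
    = E 1 E 5 E 6 E 7 E 8 E 9 E 11 E 12 E 13 E 15 E 16 E 17 E 18 E 19 E 23 E 24\<close>,
  and the other four arise from it when all indices are multiplied by a power of 3.

  By the Jacobi triple product, \<open>E r\<close> is a quotient of theta series, and theta series satisfy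
  Weierstrass' three-term relation. These relations are homogeneous, whereas claim (i) has degree 4
  on the left and degree 16 on the right. The missing inhomogeneous ingredient is the 5-dissection
  of Euler's product, a consequence of the quintuple product identity. It says that the product of
  all \<open>E r\<close> with \<open>r\<close> even, times \<open>E 10 E 20\<close>, is \<open>(E 20)\<^sup>2 - E 10 E 20 - (E 10)\<^sup>2\<close>, which turns
  the claim into a homogeneous relation that follows from the three-term relations.
\<close>

section \<open>Sums over the integers\<close>

lemma summable_on_times:
  fixes f :: "'a \<Rightarrow> real" and g :: "'b \<Rightarrow> real"
  assumes f: "f summable_on A" and g: "g summable_on B"
  shows "(\<lambda>(x, y). f x * g y) summable_on A \<times> B"
proof -
  have f': "f abs_summable_on A" and g': "g abs_summable_on B"
    using f g summable_on_iff_abs_summable_on_real by blast+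
  have "(\<lambda>(x, y). f x * g y) abs_summable_on A \<times> B"
  proof (rule abs_summable_on_Sigma_iff[THEN iffD2], intro conjI ballI)
    show "(\<lambda>y. case (x, y) of (x, y) \<Rightarrow> f x * g y) abs_summable_on B" for x
      using summable_on_cmult_right[OF g', of "\<bar>f x\<bar>"] by (simp add: abs_mult)
    have "(\<lambda>x. infsum (\<lambda>y. \<bar>g y\<bar>) B * \<bar>f x\<bar>) summable_on A"
      using f' by (intro summable_on_cmult_right) simp
    thus "(\<lambda>x. \<Sum>\<^sub>\<infinity>y\<in>B. norm (case (x, y) of (x, y) \<Rightarrow> f x * g y)) abs_summable_on A"
      using g' by (simp add: abs_mult infsum_cmult_right infsum_nonneg mult.commute)
  qed
  thus ?thesis by (rule abs_summable_summable)
qed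

lemma infsum_times:
  fixes f :: "'a \<Rightarrow> real" and g :: "'b \<Rightarrow> real"
  assumes f: "f summable_on A" and g: "g summable_on B"
  shows "infsum (\<lambda>(x, y). f x * g y) (A \<times> B) = infsum f A * infsum g B"
proof -
  have "infsum (\<lambda>(x, y). f x * g y) (A \<times> B) = infsum (\<lambda>x. infsum (\<lambda>y. f x * g y) B) A"
    using infsum_Sigma'_banach[OF summable_on_times[OF assms]] by simp
  also have "\<dots> = infsum f A * infsum g B"
    using f g by (simp add: infsum_cmult_right infsum_cmult_left)
  finally show ?thesis .
qed

lemma infsum_split_bij:
  fixes f :: "'c \<Rightarrow> 'd :: banach"
  assumes bij: "bij_betw (\<lambda>(j, x). h j x) (J \<times> UNIV) UNIV" and J: "finite J"
    and f: "f summable_on UNIV"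
  shows "infsum f UNIV = (\<Sum>j\<in>J. infsum (\<lambda>x. f (h j x)) UNIV)"
proof -
  have "(\<lambda>(j, x). f (h j x)) summable_on J \<times> UNIV"
    using summable_on_reindex_bij_betw[OF bij, of f] f by (simp add: case_prod_unfold)
  from infsum_Sigma'_banach[OF this]
  have "infsum (\<lambda>(j, x). f (h j x)) (J \<times> UNIV) = (\<Sum>j\<in>J. infsum (\<lambda>x. f (h j x)) UNIV)"
    using J by simp
  thus ?thesis
    using infsum_reindex_bij_betw[OF bij, of f] by (simp add: case_prod_unfold)
qed

lemma infsum_int_pair_split:
  fixes f :: "int \<times> int \<Rightarrow> 'a :: banach"
  assumes "bij_betw (\<lambda>(j, k, l). h j k l) ({0 :: int, 1} \<times> UNIV) UNIV" and "f summable_on UNIV"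
  shows "infsum f UNIV = (\<Sum>\<^sub>\<infinity>(k, l). f (h 0 k l)) + (\<Sum>\<^sub>\<infinity>(k, l). f (h 1 k l))"
  using infsum_split_bij[of "\<lambda>j (k, l). h j k l" "{0, 1}" f] assms by (simp add: case_prod_unfold)

lemma infsum_int_shift: "infsum (\<lambda>n. f (n + k)) UNIV = infsum f (UNIV :: int set)"
  by (rule infsum_reindex_bij_witness[of _ "\<lambda>n. n - k" "\<lambda>n. n + k"]) auto

lemma infsum_int_reflect: "infsum (\<lambda>n. f (k - n)) UNIV = infsum f (UNIV :: int set)"
  by (rule infsum_reindex_bij_witness[of _ "\<lambda>n. k - n" "\<lambda>n. k - n"]) auto

lemma tannery_infsum_int:
  fixes f :: "nat \<Rightarrow> int \<Rightarrow> real"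
  assumes lim: "\<And>n. (\<lambda>N. f N n) \<longlonglongrightarrow> g n"
    and bound: "\<And>N n. \<bar>f N n\<bar> \<le> h n" and h: "h summable_on UNIV"
  shows "(\<lambda>N. infsum (f N) UNIV) \<longlonglongrightarrow> infsum g UNIV"
proof -
  have infsum_eq: "infsum u UNIV = (\<Sum>k. u (int_decode k))"
    if "u summable_on UNIV" for u :: "int \<Rightarrow> real"
  proof -
    have "((\<lambda>k. u (int_decode k)) has_sum infsum u UNIV) UNIV"
      using has_sum_infsum[OF that] has_sum_reindex_bij_betw[OF bij_int_decode, of u] by simp
    thus ?thesis by (intro sums_unique has_sum_imp_sums)
  qed
  have summable: "u summable_on UNIV" if "\<And>n. \<bar>u n\<bar> \<le> h n" for u :: "int \<Rightarrow> real"
    using abs_summable_summable[OF abs_summable_on_comparison_test'[OF h, of u]] that by simp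
  have bound_g: "\<bar>g n\<bar> \<le> h n" for n
    by (rule LIMSEQ_le_const2[OF tendsto_rabs[OF lim]]) (use bound in auto)
  have "(\<lambda>k. h (int_decode k)) summable_on UNIV"
    using h summable_on_reindex_bij_betw[OF bij_int_decode, of h] by simp
  hence "summable (\<lambda>k. h (int_decode k))"
    by (rule summable_on_imp_summable)
  hence "(\<lambda>N. \<Sum>k. f N (int_decode k)) \<longlonglongrightarrow> (\<Sum>k. g (int_decode k))"
    by (intro tannerys_theorem[THEN conjunct2, THEN conjunct2] lim)
      (auto simp: bound intro!: always_eventually)
  thus ?thesis
    using summable[OF bound] summable[OF bound_g] by (simp add: infsum_eq)
qed

lemma summable_on_powr_abs_int:
  assumes "0 < x" "x < (1::real)"
  shows "(\<lambda>n::int. x powr \<bar>of_int n\<bar>) summable_on UNIV"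
proof -
  have geometric: "(\<lambda>n::nat. x powr real n) summable_on UNIV"
    using assms
    by (auto simp: powr_realpow intro!: norm_summable_imp_summable_on summable_geometric)
  have "(\<lambda>n::int. x powr \<bar>of_int n\<bar>) summable_on range int"
    using geometric by (subst summable_on_reindex) (auto simp: o_def)
  moreover have "(\<lambda>n::int. x powr \<bar>of_int n\<bar>) summable_on range (\<lambda>k. - int k)"
    using geometric by (subst summable_on_reindex) (auto simp: o_def inj_on_def)
  ultimately have "(\<lambda>n::int. x powr \<bar>of_int n\<bar>) summable_on range int \<union> range (\<lambda>k. - int k)"
    by (rule summable_on_union)
  moreover have "range int \<union> range (\<lambda>k. - int k) = (UNIV :: int set)"
    by (auto intro: int_cases2)
  ultimately show ?thesis by simp
qed

lemma summable_on_powr_quadratic: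
  assumes q: "0 < q" "q < (1::real)" and a: "a > 0"
  shows "(\<lambda>n::int. q powr (a * (of_int n)\<^sup>2 + b * of_int n + c)) summable_on UNIV"
proof -
  define K where "K = (\<bar>b\<bar> + 1)\<^sup>2 / (4 * a)"
  have "(\<lambda>n::int. q powr (c - K) * q powr \<bar>of_int n\<bar>) summable_on UNIV"
    by (intro summable_on_cmult_right summable_on_powr_abs_int q)
  moreover have "norm (q powr (a * (of_int n)\<^sup>2 + b * of_int n + c))
      \<le> q powr (c - K) * q powr \<bar>of_int n\<bar>" for n :: int
  proof -
    define t where "t = \<bar>real_of_int n\<bar>"
    have "0 \<le> a * (t - (\<bar>b\<bar> + 1) / (2 * a))\<^sup>2" using a by simp
    also have "\<dots> = a * t\<^sup>2 - (\<bar>b\<bar> + 1) * t + K"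
      using a by (simp add: K_def power2_eq_square field_simps)
    finally have "t - K \<le> a * t\<^sup>2 - \<bar>b\<bar> * t" by (simp add: algebra_simps)
    moreover have "- (\<bar>b\<bar> * t) \<le> b * of_int n"
      unfolding t_def abs_mult[symmetric] by linarith
    ultimately have "c - K + t \<le> a * (of_int n)\<^sup>2 + b * of_int n + c"
      by (simp add: t_def)
    hence "q powr (a * (of_int n)\<^sup>2 + b * of_int n + c) \<le> q powr (c - K + t)"
      using q by (simp add: powr_mono')
    thus ?thesis using q by (simp add: powr_add t_def)
  qed
  ultimately show ?thesis
    by (rule abs_summable_summable[OF abs_summable_on_comparison_test'])
qed

section \<open>Theta series\<close>

text \<open>The exponents are complete squares, so that no powers of \<open>q\<close> enter the functional equations.\<close>

definition theta_exponent :: "real \<Rightarrow> real \<Rightarrow> int \<Rightarrow> real" where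
  "theta_exponent p r n = (p * of_int n + r)\<^sup>2 / (2 * p)"

definition theta_term :: "real \<Rightarrow> real \<Rightarrow> real \<Rightarrow> int \<Rightarrow> real" where
  "theta_term q p r n = (-1) powi n * q powr theta_exponent p (r - p / 2) n"

definition theta :: "real \<Rightarrow> real \<Rightarrow> real \<Rightarrow> real" where
  "theta q p r = infsum (theta_term q p r) UNIV"

definition unsigned_theta :: "real \<Rightarrow> real \<Rightarrow> real \<Rightarrow> real" where
  "unsigned_theta q p r = (\<Sum>\<^sub>\<infinity>n. q powr theta_exponent p r n)"

definition three_term :: "('a::ring \<Rightarrow> real) \<Rightarrow> 'a \<Rightarrow> 'a \<Rightarrow> 'a \<Rightarrow> 'a \<Rightarrow> real" where
  "three_term f x y u v =
    f (x + y) * f (x - y) * (f (u + v) * f (u - v))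
    - f (x + u) * f (x - u) * (f (y + v) * f (y - v))
    + f (x + v) * f (x - v) * (f (y + u) * f (y - u))"

lemma minus_one_powi_add: "(-1::real) powi (m + n) = (-1) powi m * (-1) powi n"
  by (simp add: power_int_add)

lemma minus_one_powi_diff: "(-1::real) powi (m - n) = (-1) powi m * (-1) powi n"
  by (cases "even m"; cases "even n") auto

lemma theta_minus: "theta q p (- r) = - theta q p r"
proof -
  have "theta_term q p (- r) (1 - n) = - theta_term q p r n" for n
  proof -
    have "theta_exponent p (- r - p / 2) (1 - n) = theta_exponent p (r - p / 2) n"
      by (simp add: theta_exponent_def power2_eq_square field_simps)
    thus ?thesis by (simp only: theta_term_def minus_one_powi_diff) simp
  qed
  thus ?thesis
    using infsum_int_reflect[of "theta_term q p (- r)" 1] by (simp add: theta_def infsum_uminus)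
qed

lemma theta_add_int_period: "theta q p (r + of_int m * p) = (-1) powi m * theta q p r"
proof -
  have "theta_term q p (r + of_int m * p) = (\<lambda>n. (-1) powi m * theta_term q p r (n + m))"
    by (simp add: fun_eq_iff theta_term_def theta_exponent_def minus_one_powi_add algebra_simps)
  thus ?thesis
    by (simp add: theta_def infsum_cmult_right' infsum_int_shift)
qed

lemma theta_add_period: "theta q p (r + p) = - theta q p r"
  using theta_add_int_period[of q p r 1] by simp

lemma theta_period_minus: "theta q p (p - r) = theta q p r"
  using theta_add_period[of q p "- r"] by (simp add: theta_minus)

lemma unsigned_theta_add_period: "unsigned_theta q p (r + p) = unsigned_theta q p r"
proof -
  have "unsigned_theta q p r = (\<Sum>\<^sub>\<infinity>n. q powr theta_exponent p r (n + 1))"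
    unfolding unsigned_theta_def by (rule infsum_int_shift[symmetric])
  thus ?thesis unfolding unsigned_theta_def by (simp add: theta_exponent_def algebra_simps)
qed

context
  fixes q p :: real
  assumes q: "0 < q" "q < 1" and p: "p > 0"
begin

lemma summable_on_unsigned_theta: "(\<lambda>n. q powr theta_exponent p r n) summable_on UNIV"
proof -
  have "theta_exponent p r = (\<lambda>n. p / 2 * (of_int n)\<^sup>2 + r * of_int n + r\<^sup>2 / (2 * p))"
    using p by (auto simp: theta_exponent_def power2_eq_square field_simps)
  thus ?thesis
    using summable_on_powr_quadratic[OF q, of "p / 2" r "r\<^sup>2 / (2 * p)"] p by simp
qed

lemma summable_on_theta_term: "theta_term q p r summable_on UNIV"
proof -
  have "\<bar>(-1 :: real) powi n\<bar> = 1" for n by (cases "even n") auto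
  hence "(\<lambda>n. norm (theta_term q p r n)) summable_on UNIV"
    using summable_on_unsigned_theta by (simp add: theta_term_def abs_mult)
  thus ?thesis by (rule abs_summable_summable)
qed

end

lemma theta_term_mult:
  "theta_term q a r m * theta_term q b s n
    = (-1) powi (m + n) * q powr (theta_exponent a (r - a / 2) m + theta_exponent b (s - b / 2) n)"
  by (simp add: theta_term_def minus_one_powi_add powr_add)

lemma
  fixes q a b :: real
  assumes q: "0 < q" "q < 1" and "a > 0" "b > 0"
  shows summable_on_theta_term_times:
      "(\<lambda>(m, n). theta_term q a r m * theta_term q b s n) summable_on UNIV"
    and infsum_theta_term_times:
      "infsum (\<lambda>(m, n). theta_term q a r m * theta_term q b s n) UNIV = theta q a r * theta q b s"
  using summable_on_times[OF summable_on_theta_term[OF q] summable_on_theta_term[OF q]]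
    infsum_times[OF summable_on_theta_term[OF q] summable_on_theta_term[OF q]] assms(3,4)
  by (simp_all add: theta_def)

context
  fixes q p :: real
  assumes q: "0 < q" "q < 1" and p: "p > 0"
begin

text \<open>The double series splits according to the parity of the sum of the two summation indices;
  in the coordinates given by their sum and difference both parts factor.\<close>

lemma theta_mult:
  "theta q p (x + y) * theta q p (x - y)
    = unsigned_theta q (2 * p) (2 * x + p) * unsigned_theta q (2 * p) (2 * y)
    - unsigned_theta q (2 * p) (2 * x) * unsigned_theta q (2 * p) (2 * y + p)"
proof -
  define F where "F = (\<lambda>(m, n). theta_term q p (x + y) m * theta_term q p (x - y) n)"
  define U where "U r n = q powr theta_exponent (2 * p) r n" for r n
  have infsum_U: "(\<Sum>\<^sub>\<infinity>(k, l). U r k * U s l)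
      = unsigned_theta q (2 * p) r * unsigned_theta q (2 * p) s" for r s
    using infsum_times[of "U r" UNIV "U s" UNIV] summable_on_unsigned_theta[OF q, of "2 * p"] p
    by (simp add: U_def[abs_def] unsigned_theta_def)
  have "bij_betw (\<lambda>(j, k, l). (k + l + j, k - l)) ({0, 1} \<times> UNIV) (UNIV :: (int \<times> int) set)"
    by (rule bij_betwI[of _ _ _ "\<lambda>(m, n). ((m + n) mod 2, (m + n) div 2, (m + n) div 2 - n)"])
      (auto, presburger)
  from infsum_int_pair_split[OF this, of F]
  have "infsum F UNIV = (\<Sum>\<^sub>\<infinity>(k, l). F (k + l, k - l)) + (\<Sum>\<^sub>\<infinity>(k, l). F (k + l + 1, k - l))"
    using summable_on_theta_term_times[OF q p p] by (simp add: F_def)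
  also have "(\<lambda>(k, l). F (k + l, k - l)) = (\<lambda>(k, l). U (2 * x - p) k * U (2 * y) l)"
  proof (intro ext, clarify)
    fix k l
    have "theta_exponent p (x + y - p / 2) (k + l) + theta_exponent p (x - y - p / 2) (k - l)
        = theta_exponent (2 * p) (2 * x - p) k + theta_exponent (2 * p) (2 * y) l"
      using p by (simp add: theta_exponent_def power2_eq_square field_simps)
    thus "F (k + l, k - l) = U (2 * x - p) k * U (2 * y) l"
      by (simp add: F_def theta_term_mult U_def powr_add[symmetric])
  qed
  also have "(\<lambda>(k, l). F (k + l + 1, k - l)) = (\<lambda>(k, l). - (U (2 * x) k * U (2 * y + p) l))"
  proof (intro ext, clarify)
    fix k l
    have "theta_exponent p (x + y - p / 2) (k + l + 1) + theta_exponent p (x - y - p / 2) (k - l)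
        = theta_exponent (2 * p) (2 * x) k + theta_exponent (2 * p) (2 * y + p) l"
      using p by (simp add: theta_exponent_def power2_eq_square field_simps)
    thus "F (k + l + 1, k - l) = - (U (2 * x) k * U (2 * y + p) l)"
      by (simp add: F_def theta_term_mult U_def powr_add[symmetric])
  qed
  also have "infsum F UNIV = theta q p (x + y) * theta q p (x - y)"
    unfolding F_def by (rule infsum_theta_term_times[OF q p p])
  finally show ?thesis
    using unsigned_theta_add_period[of q "2 * p" "2 * x - p"]
    by (simp add: case_prod_unfold infsum_uminus infsum_U[unfolded case_prod_unfold] add.commute)
qed

theorem three_term_theta: "three_term (theta q p) x y u v = 0"
  unfolding three_term_def theta_mult by algebra

end

section \<open>Quintuple product and 5-dissection\<close>

text \<open>Dedekind's eta function at \<open>p * \<tau>\<close>, where \<open>q = exp (2 * \<pi> * \<i> * \<tau>)\<close>.\<close>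

definition eta :: "real \<Rightarrow> real \<Rightarrow> real" where
  "eta q p = theta q (3 * p) p"

text \<open>The terms of each of the three double series are split by a parity, with coordinates
  \<open>(M, n)\<close> chosen so that two of the six parts cancel and the other four agree in pairs.\<close>

theorem quintuple_product:
  assumes q: "0 < q" "q < 1" and p: "p > 0"
  shows "(theta q (3 * p) (2 * p - 3 * r) + theta q (3 * p) (2 * p + 3 * r)) * theta q p r
    = theta q p (2 * r) * eta q p"
proof -
  define G where
    "G s = (\<lambda>(n, l). theta_term q (3 * p) (2 * p + s * (3 * r)) n * theta_term q p r l)" for s
  define K where "K = (\<lambda>(m, l). theta_term q p (2 * r) m * theta_term q (3 * p) p l)"
  have p3: "3 * p > 0" using p by simp
  have summable: "G s summable_on UNIV" "K summable_on UNIV" for s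
    unfolding G_def K_def by (rule summable_on_theta_term_times[OF q] p p3)+
  have infsum: "infsum (G s) UNIV = theta q (3 * p) (2 * p + s * (3 * r)) * theta q p r"
      "infsum K UNIV = theta q p (2 * r) * theta q (3 * p) p" for s
    unfolding G_def K_def by (rule infsum_theta_term_times[OF q] p p3)+
  note expand = G_def K_def theta_term_mult theta_exponent_def power2_eq_square field_simps
  have "bij_betw (\<lambda>(j, M, n). (n, 2 * M + 3 * n + j)) ({0, 1} \<times> UNIV) (UNIV :: (int \<times> int) set)"
    by (rule bij_betwI[of _ _ _ "\<lambda>(n, l). ((l - 3 * n) mod 2, (l - 3 * n) div 2, n)"]) auto
  note split_minus = infsum_int_pair_split[OF this summable(1), of "-1"]
  have "bij_betw (\<lambda>(j, M, n). (n + M, j - 1 - M - 3 * n)) ({0, 1} \<times> UNIV) (UNIV :: (int \<times> int) set)"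
    by (rule bij_betwI[of _ _ _
          "\<lambda>(m, l). ((m + l + 1) mod 2, m + (m + l + 1) div 2, - ((m + l + 1) div 2))"])
      (auto, presburger+)
  note split_plus = infsum_int_pair_split[OF this summable(1), of 1]
  have "bij_betw (\<lambda>(j, M, n). (M, 2 * n + M + j)) ({0, 1} \<times> UNIV) (UNIV :: (int \<times> int) set)"
    by (rule bij_betwI[of _ _ _ "\<lambda>(M, l). ((l - M) mod 2, M, (l - M) div 2)"]) auto
  note split_K = infsum_int_pair_split[OF this summable(2)]
  have "G (-1) (n, 2 * M + 3 * n) = K (M, 2 * n + M)" for M n
    using p by (simp add: expand)
  moreover have "G 1 (n + M, - 1 - M - 3 * n) = K (M, 2 * n + M + 1)" for M n
    using p by (simp add: expand)
  moreover have "G (-1) (n, 2 * M + 3 * n + 1) = - G 1 (n + M, - M - 3 * n)" for M n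
    using p by (simp add: expand)
  ultimately have "infsum (G (-1)) UNIV + infsum (G 1) UNIV = infsum K UNIV"
    unfolding split_minus split_plus split_K by (simp add: case_prod_unfold infsum_uminus)
  thus ?thesis unfolding infsum by (simp add: eta_def distrib_right)
qed

lemma eta_split_mod_5:
  assumes q: "0 < q" "q < 1" and p: "p > 0"
  defines "t \<equiv> theta q (75 * p)"
  shows "eta q p = t (35 * p) - t (50 * p) + t (65 * p) - t (80 * p) + t (95 * p)"
proof -
  have term_mod_5: "theta_term q (3 * p) p (5 * m + j)
      = (-1) powi j * theta_term q (75 * p) ((35 + 15 * of_int j) * p) m" for j m
  proof -
    have "theta_exponent (3 * p) (p - 3 * p / 2) (5 * m + j)
        = theta_exponent (75 * p) ((35 + 15 * of_int j) * p - 75 * p / 2) m"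
      using p by (simp add: theta_exponent_def power2_eq_square field_simps)
    moreover have "(-1 :: real) powi (5 * m + j) = (-1) powi j * (-1) powi m"
      by (cases "even m"; cases "even j") auto
    ultimately show ?thesis by (simp only: theta_term_def mult.assoc)
  qed
  have "bij_betw (\<lambda>(j, m). 5 * m + j) ({0, 1, 2, 3, 4} \<times> UNIV) (UNIV :: int set)"
    by (rule bij_betwI[of _ _ _ "\<lambda>n. (n mod 5, n div 5)"]) auto
  moreover have "theta_term q (3 * p) p summable_on UNIV"
    using p by (intro summable_on_theta_term q) simp
  ultimately have "infsum (theta_term q (3 * p) p) UNIV
      = (\<Sum>j\<in>{0, 1, 2, 3, 4}. infsum (\<lambda>m. theta_term q (3 * p) p (5 * m + j)) UNIV)"
    by (intro infsum_split_bij) auto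
  also have "\<dots> = (\<Sum>j\<in>{0, 1, 2, 3, 4}. (-1) powi j * t ((35 + 15 * of_int j) * p))"
    by (simp only: term_mod_5 infsum_cmult_right') (simp add: t_def theta_def)
  finally show ?thesis by (simp add: eta_def theta_def)
qed

theorem eta_dissection_5:
  assumes q: "0 < q" "q < 1" and p: "p > 0"
  defines "t \<equiv> theta q (25 * p)"
  shows "eta q p * (t (5 * p) * t (10 * p))
    = eta q (25 * p) * ((t (10 * p))\<^sup>2 - t (5 * p) * t (10 * p) - (t (5 * p))\<^sup>2)"
proof -
  define t' where "t' = theta q (75 * p)"
  have "eta q p = t' (35 * p) - t' (50 * p) + t' (65 * p) - t' (80 * p) + t' (95 * p)"
    unfolding t'_def by (rule eta_split_mod_5[OF q p])
  moreover have "t' (50 * p) = eta q (25 * p)"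
    using theta_period_minus[of q "75 * p" "25 * p"] by (simp add: t'_def eta_def)
  moreover have "t' (95 * p) = - t' (20 * p)"
    using theta_add_period[of q "75 * p" "20 * p"] by (simp add: t'_def)
  moreover have "(t' (35 * p) + t' (65 * p)) * t (5 * p) = t (10 * p) * eta q (25 * p)"
    using quintuple_product[OF q, of "25 * p" "5 * p"] p by (simp add: t_def t'_def)
  moreover have "(t' (20 * p) + t' (80 * p)) * t (10 * p) = t (5 * p) * eta q (25 * p)"
  proof -
    have "t (20 * p) = t (5 * p)"
      using theta_period_minus[of q "25 * p" "5 * p"] by (simp add: t_def)
    thus ?thesis
      using quintuple_product[OF q, of "25 * p" "10 * p"] p by (simp add: t_def t'_def)
  qed
  ultimately show ?thesis by algebra
qed

section \<open>Infinite q-products\<close>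

definition qprod :: "real \<Rightarrow> nat set \<Rightarrow> real" where
  "qprod q S = (\<Prod>m. if m \<in> S then 1 - q ^ m else 1)"

context
  fixes q :: real
  assumes q: "0 < q" "q < 1"
begin

lemma one_minus_power_pos: "0 < m \<Longrightarrow> 0 < 1 - q ^ m"
  using q by (simp add: power_less_one_iff)

lemma convergent_qprod:
  assumes "0 \<notin> S"
  shows "convergent_prod (\<lambda>m. if m \<in> S then 1 - q ^ m else 1)"
proof -
  define f where "f m = (if m \<in> S then - (q ^ m) else 0)" for m
  have "summable (\<lambda>m. norm (f m))"
    by (rule summable_comparison_test[of _ "\<lambda>m. q ^ m"])
      (use q in \<open>auto simp: f_def intro!: exI[of _ 0]\<close>)
  hence "convergent_prod (\<lambda>m. 1 + f m)"
    by (intro abs_convergent_prod_imp_convergent_prod summable_imp_abs_convergent_prod) simp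
  moreover have "(\<lambda>m. 1 + f m) = (\<lambda>m. if m \<in> S then 1 - q ^ m else 1)"
    by (auto simp: f_def)
  ultimately show ?thesis by simp
qed

lemma qprod_LIMSEQ:
  assumes "0 \<notin> S"
  shows "(\<lambda>N. \<Prod>m<N. if m \<in> S then 1 - q ^ m else 1) \<longlonglongrightarrow> qprod q S"
  using convergent_prod_LIMSEQ[OF convergent_qprod[OF assms]]
  by (simp only: qprod_def LIMSEQ_lessThan_iff_atMost)

lemma qprod_pos:
  assumes "0 \<notin> S"
  shows "0 < qprod q S"
  unfolding qprod_def
proof (rule less_0_prodinf[OF convergent_qprod[OF assms]])
  show "0 < (if m \<in> S then 1 - q ^ m else 1)" for m
    using assms one_minus_power_pos[of m] by (cases m) auto
qed

lemma qprod_Un: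
  assumes "0 \<notin> S" "0 \<notin> T" "S \<inter> T = {}"
  shows "qprod q (S \<union> T) = qprod q S * qprod q T"
  unfolding qprod_def
  by (subst prodinf_mult) (use assms in \<open>auto intro!: convergent_qprod prodinf_cong\<close>)

lemma qprod_range_LIMSEQ:
  assumes f: "strict_mono f" and f0: "0 < f 0"
  shows "(\<lambda>N. \<Prod>i<N. 1 - q ^ f i) \<longlonglongrightarrow> qprod q (range f)"
proof -
  have "0 \<notin> range f"
    using f0 strict_mono_less_eq[OF f, of 0] by (metis imageE le0 not_le)
  hence "(\<lambda>N. \<Prod>m<f N. if m \<in> range f then 1 - q ^ m else 1) \<longlonglongrightarrow> qprod q (range f)"
    using filterlim_compose[OF qprod_LIMSEQ filterlim_subseq[OF f]] by blast
  moreover have "(\<Prod>m<f N. if m \<in> range f then 1 - q ^ m else 1) = (\<Prod>i<N. 1 - q ^ f i)" for N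
  proof -
    have "{..<f N} \<inter> range f = f ` {..<N}"
      using strict_mono_less[OF f] by auto
    hence "(\<Prod>m<f N. if m \<in> range f then 1 - q ^ m else 1) = (\<Prod>m\<in>f ` {..<N}. 1 - q ^ m)"
      by (simp add: prod.inter_restrict[symmetric])
    also have "\<dots> = (\<Prod>i<N. 1 - q ^ f i)"
      using strict_mono_eq[OF f] by (subst prod.reindex) (auto simp: inj_on_def)
    finally show ?thesis .
  qed
  ultimately show ?thesis by simp
qed

end

section \<open>Jacobi triple product\<close>

definition qfact :: "real \<Rightarrow> nat \<Rightarrow> real" where
  "qfact q n = (\<Prod>i<n. 1 - q ^ Suc i)"

fun qbinomial :: "real \<Rightarrow> nat \<Rightarrow> nat \<Rightarrow> real" where
  "qbinomial q n 0 = 1"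
| "qbinomial q 0 (Suc k) = 0"
| "qbinomial q (Suc n) (Suc k) = qbinomial q n (Suc k) + q ^ (n - k) * qbinomial q n k"

lemma qfact_0 [simp]: "qfact q 0 = 1"
  and qfact_Suc: "qfact q (Suc n) = qfact q n * (1 - q ^ Suc n)"
  by (simp_all add: qfact_def)

lemma qbinomial_eq_0: "n < k \<Longrightarrow> qbinomial q n k = 0"
  by (induction q n k rule: qbinomial.induct) auto

lemma qbinomial_theorem:
  "(\<Prod>i<n. 1 + x * q ^ i) = (\<Sum>k\<le>n. qbinomial q n k * q ^ (k choose 2) * x ^ k)"
proof (induction n)
  case (Suc n)
  define s where "s k = qbinomial q n k * q ^ (k choose 2) * x ^ k" for k
  have Pascal: "qbinomial q (Suc n) (Suc k) * q ^ (Suc k choose 2) * x ^ Suc k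
      = s (Suc k) + x * q ^ n * s k" if "k \<le> n" for k
  proof -
    have "q ^ (Suc k choose 2) = q ^ k * q ^ (k choose 2)"
      by (simp add: power_add[symmetric] numeral_2_eq_2)
    moreover have "q ^ n = q ^ (n - k) * q ^ k"
      using that by (simp add: power_add[symmetric])
    ultimately show ?thesis by (simp add: s_def algebra_simps)
  qed
  have "(\<Sum>k\<le>Suc n. qbinomial q (Suc n) k * q ^ (k choose 2) * x ^ k)
      = s 0 + (\<Sum>k\<le>n. s (Suc k) + x * q ^ n * s k)"
    unfolding sum.atMost_Suc_shift
    by (intro arg_cong2[of _ _ _ _ "(+)"] sum.cong)
      (auto simp: s_def Pascal simp del: power_Suc qbinomial.simps(3))
  also have "\<dots> = (\<Sum>k\<le>Suc n. s k) + x * q ^ n * (\<Sum>k\<le>n. s k)"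
    by (simp only: sum.atMost_Suc_shift[of s] sum.distrib sum_distrib_left add.assoc)
  also have "\<dots> = (\<Prod>i<Suc n. 1 + x * q ^ i)"
    using Suc by (simp add: s_def qbinomial_eq_0 algebra_simps)
  finally show ?case by simp
qed (simp add: choose_two)

lemma qbinomial_mult_qfact:
  "k \<le> n \<Longrightarrow> qbinomial q n k * qfact q k * qfact q (n - k) = qfact q n"
proof (induction n arbitrary: k)
  case (Suc n)
  show ?case
  proof (cases k)
    case k: (Suc j)
    hence "j \<le> n" using Suc.prems by simp
    have upper: "qbinomial q n k * qfact q k * qfact q (n - j) = (1 - q ^ (n - j)) * qfact q n"
    proof (cases "j = n")
      case False
      hence "n - j = Suc (n - k)" and "k \<le> n" using k \<open>j \<le> n\<close> by auto
      thus ?thesis using Suc.IH[of k] by (simp add: qfact_Suc)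
    qed (simp add: k qbinomial_eq_0)
    have "qbinomial q (Suc n) k * qfact q k * qfact q (Suc n - k)
        = qbinomial q n k * qfact q k * qfact q (n - j)
          + q ^ (n - j) * (1 - q ^ Suc j) * (qbinomial q n j * qfact q j * qfact q (n - j))"
      by (simp add: k qfact_Suc algebra_simps)
    also have "\<dots> = (1 - q ^ (n - j)) * qfact q n + q ^ (n - j) * (1 - q ^ Suc j) * qfact q n"
      by (simp only: upper Suc.IH[OF \<open>j \<le> n\<close>])
    also have "\<dots> = (1 - q ^ (n - j) * q ^ Suc j) * qfact q n"
      by (simp add: algebra_simps)
    also have "q ^ (n - j) * q ^ Suc j = q ^ Suc n"
      using \<open>j \<le> n\<close> by (simp add: power_add[symmetric])
    finally show ?thesis by (simp add: qfact_Suc)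
  qed simp
qed simp

definition jacobi_term :: "real \<Rightarrow> real \<Rightarrow> int \<Rightarrow> real" where
  "jacobi_term q z n = (-1) powi n * (q powr (of_int n * (of_int n - 1) / 2) * z powr of_int n)"

lemma jacobi_term_of_nat:
  assumes "0 < q" "0 < z"
  shows "jacobi_term q z (int k) = q ^ (k choose 2) * (- z) ^ k"
proof -
  have "real k * (real k - 1) / 2 = real (k choose 2)"
    by (induction k) (auto simp: numeral_2_eq_2 field_simps)
  hence "q powr (real k * (real k - 1) / 2) = q ^ (k choose 2)"
    using assms by (simp only: powr_realpow)
  thus ?thesis
    using assms by (simp add: jacobi_term_def powr_realpow power_minus[of z])
qed

lemma jacobi_term_shift:
  assumes "0 < q" "0 < z"
  shows "- (q / z) * jacobi_term q (z / q) (n + 1) = jacobi_term q z n"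
proof -
  define x :: real where "x = of_int n"
  have "(x + 1) * (x + 1 - 1) / 2 = x * (x - 1) / 2 + x" by (simp add: field_simps)
  hence "q powr ((x + 1) * (x + 1 - 1) / 2) = q powr (x * (x - 1) / 2) * q powr x"
    by (simp only: powr_add)
  thus ?thesis
    using assms by (simp add: jacobi_term_def minus_one_powi_add powr_add powr_divide flip: x_def)
qed

text \<open>Replacing \<open>z\<close> by \<open>z / q\<close> moves one factor from the first product to the second.\<close>

lemma finite_jacobi_triple_product:
  assumes q: "0 < q" and z: "0 < z"
  shows "(\<Prod>i<M. 1 - z * q ^ i) * (\<Prod>i<N. 1 - q ^ Suc i / z)
    = (\<Sum>n\<in>{- int N..int M}. jacobi_term q z n * qbinomial q (M + N) (nat (int N + n)))"
  using z
proof (induction N arbitrary: M z)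
  case 0
  have "(\<Prod>i<M. 1 - z * q ^ i) = (\<Sum>k\<le>M. jacobi_term q z (int k) * qbinomial q M k)"
    using qbinomial_theorem[of "- z" q M] 0 q by (simp add: jacobi_term_of_nat mult_ac)
  also have "\<dots> = (\<Sum>n\<in>{0..int M}. jacobi_term q z n * qbinomial q M (nat n))"
    by (rule sum.reindex_bij_witness[of _ nat int]) auto
  finally show ?case by simp
next
  case (Suc N)
  have "(\<Prod>i<Suc M. 1 - z / q * q ^ i) = (1 - z / q) * (\<Prod>i<M. 1 - z * q ^ i)"
    using q by (simp add: prod.lessThan_Suc_shift del: prod.lessThan_Suc)
  moreover have "(\<Prod>i<Suc N. 1 - q ^ Suc i / z) = (1 - q / z) * (\<Prod>i<N. 1 - q ^ Suc i / (z / q))"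
    using q by (simp add: prod.lessThan_Suc_shift mult.commute del: prod.lessThan_Suc)
  moreover have "1 - q / z = - (q / z) * (1 - z / q)"
    using q Suc.prems by (simp add: field_simps)
  ultimately have "(\<Prod>i<M. 1 - z * q ^ i) * (\<Prod>i<Suc N. 1 - q ^ Suc i / z)
      = - (q / z) * ((\<Prod>i<Suc M. 1 - z / q * q ^ i) * (\<Prod>i<N. 1 - q ^ Suc i / (z / q)))"
    by (simp only: mult_ac)
  also have "\<dots> = (\<Sum>n\<in>{- int N..int (Suc M)}.
      jacobi_term q z (n - 1) * qbinomial q (M + Suc N) (nat (int N + n)))"
    using Suc.prems q jacobi_term_shift[OF q Suc.prems, of "n - 1" for n]
    by (subst Suc.IH) (simp_all add: sum_distrib_left mult.assoc[symmetric] del: mult_minus_left)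
  also have "\<dots> = (\<Sum>n\<in>{- int (Suc N)..int M}.
      jacobi_term q z n * qbinomial q (M + Suc N) (nat (int (Suc N) + n)))"
    by (rule sum.reindex_bij_witness[of _ "\<lambda>n. n + 1" "\<lambda>n. n - 1"]) (auto simp: algebra_simps)
  finally show ?case .
qed

context
  fixes q :: real
  assumes q: "0 < q" "q < 1"
begin

lemma qfact_pos: "0 < qfact q n"
  unfolding qfact_def by (intro prod_pos ballI one_minus_power_pos q) simp

lemma qfact_le_1: "qfact q n \<le> 1"
  unfolding qfact_def using q
  by (intro prod_le_1) (auto simp: power_le_one simp del: power_Suc)

lemma qfact_LIMSEQ: "qfact q \<longlonglongrightarrow> qprod q {0<..}"
proof -
  have "(\<lambda>N. \<Prod>i<N. 1 - q ^ Suc i) \<longlonglongrightarrow> qprod q (range Suc)"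
    by (rule qprod_range_LIMSEQ[OF q]) (simp_all add: strict_mono_Suc_iff)
  moreover have "range Suc = {0<..}"
    using greaterThan_0 by simp
  ultimately show ?thesis
    by (simp add: qfact_def[abs_def])
qed

lemma qprod_le_qfact: "qprod q {0<..} \<le> qfact q n"
proof (rule decseq_ge[OF decseq_SucI qfact_LIMSEQ])
  show "qfact q (Suc n) \<le> qfact q n" for n
    unfolding qfact_Suc using q qfact_pos[of n]
    by (simp add: mult_le_cancel_left1 del: power_Suc)
qed

lemma qbinomial_eq_qfact:
  assumes "k \<le> n"
  shows "qbinomial q n k = qfact q n / (qfact q k * qfact q (n - k))"
  using qbinomial_mult_qfact[OF assms, of q] qfact_pos[of k] qfact_pos[of "n - k"]
  by (simp add: field_simps)

lemma abs_qbinomial_le: "\<bar>qbinomial q n k\<bar> \<le> 1 / (qprod q {0<..})\<^sup>2"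
proof (cases "k \<le> n")
  case True
  have "qfact q n / (qfact q k * qfact q (n - k)) \<le> 1 / (qprod q {0<..} * qprod q {0<..})"
    using qprod_pos[OF q, of "{0<..}"]
    by (intro frac_le mult_mono mult_pos_pos qprod_le_qfact qfact_le_1)
      (auto intro: less_imp_le qfact_pos)
  moreover have "0 \<le> qbinomial q n k"
    by (simp add: qbinomial_eq_qfact[OF True] qfact_pos less_imp_le)
  ultimately show ?thesis
    by (simp add: qbinomial_eq_qfact[OF True] power2_eq_square)
qed (simp add: qbinomial_eq_0)

lemma central_qbinomial_LIMSEQ:
  "(\<lambda>N. qbinomial q (N + N) (nat (int N + n))) \<longlonglongrightarrow> 1 / qprod q {0<..}"
proof -
  define L where "L = qprod q {0<..}"
  have "filterlim (\<lambda>N. nat (int N + k)) sequentially sequentially" for k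
    unfolding filterlim_at_top
  proof
    fix Z show "\<forall>\<^sub>F N in sequentially. Z \<le> nat (int N + k)"
      using eventually_ge_at_top[of "Z + nat \<bar>k\<bar>"] by eventually_elim auto
  qed
  hence qfact_shift: "(\<lambda>N. qfact q (nat (int N + k))) \<longlonglongrightarrow> L" for k
    unfolding L_def by (rule filterlim_compose[OF qfact_LIMSEQ])
  have "(\<lambda>N. qfact q (N + N)) \<longlonglongrightarrow> L"
    unfolding L_def
    by (rule filterlim_compose[OF qfact_LIMSEQ]) (simp add: filterlim_subseq strict_mono_def)
  moreover have "L > 0"
    unfolding L_def by (rule qprod_pos[OF q]) simp
  ultimately have "(\<lambda>N. qfact q (N + N) / (qfact q (nat (int N + n)) * qfact q (nat (int N + - n))))
      \<longlonglongrightarrow> L / (L * L)"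
    by (intro tendsto_divide tendsto_mult qfact_shift) auto
  moreover have "\<forall>\<^sub>F N in sequentially.
      qfact q (N + N) / (qfact q (nat (int N + n)) * qfact q (nat (int N + - n)))
        = qbinomial q (N + N) (nat (int N + n))"
    using eventually_ge_at_top[of "nat \<bar>n\<bar>"]
  proof eventually_elim
    case (elim N)
    hence "nat (int N + n) \<le> N + N" and "N + N - nat (int N + n) = nat (int N + - n)" by auto
    thus ?case by (simp add: qbinomial_eq_qfact)
  qed
  ultimately have "(\<lambda>N. qbinomial q (N + N) (nat (int N + n))) \<longlonglongrightarrow> L / (L * L)"
    by (rule Lim_transform_eventually)
  thus ?thesis using \<open>L > 0\<close> by (simp add: L_def)
qed

lemma abs_jacobi_term_summable_on:
  assumes z: "0 < z"
  shows "(\<lambda>n. \<bar>jacobi_term q z n\<bar>) summable_on UNIV"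
proof -
  have "\<bar>jacobi_term q z n\<bar>
      = q powr (1 / 2 * (of_int n)\<^sup>2 + (log q z - 1 / 2) * of_int n + 0)" for n
  proof -
    have "z powr of_int n = q powr (log q z * of_int n)"
      using q z by (simp add: powr_powr[symmetric] powr_log_cancel)
    moreover have "\<bar>(-1 :: real) powi n\<bar> = 1" by (cases "even n") auto
    ultimately show ?thesis
      by (simp add: jacobi_term_def abs_mult powr_add[symmetric] power2_eq_square field_simps)
  qed
  thus ?thesis
    using summable_on_powr_quadratic[OF q, of "1 / 2" "log q z - 1 / 2" 0] by simp
qed

theorem jacobi_triple_product_LIMSEQ:
  assumes z: "0 < z"
  shows "(\<lambda>N. (\<Prod>i<N. 1 - z * q ^ i) * (\<Prod>i<N. 1 - q ^ Suc i / z) * (\<Prod>i<N. 1 - q ^ Suc i))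
    \<longlonglongrightarrow> infsum (jacobi_term q z) UNIV"
proof -
  define L where "L = qprod q {0<..}"
  have "L > 0" unfolding L_def by (rule qprod_pos[OF q]) simp
  define f where "f N n = (if n \<in> {- int N..int N}
    then jacobi_term q z n * qbinomial q (N + N) (nat (int N + n)) else 0)" for N n
  have "(\<lambda>N. infsum (f N) UNIV) \<longlonglongrightarrow> infsum (\<lambda>n. jacobi_term q z n * (1 / L)) UNIV"
  proof (rule tannery_infsum_int)
    show "(\<lambda>n. \<bar>jacobi_term q z n\<bar> * (1 / L\<^sup>2)) summable_on UNIV"
      by (intro summable_on_cmult_left abs_jacobi_term_summable_on z)
    show "\<bar>f N n\<bar> \<le> \<bar>jacobi_term q z n\<bar> * (1 / L\<^sup>2)" for N n
      using mult_left_mono[OF abs_qbinomial_le, of "\<bar>jacobi_term q z n\<bar>"]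
      by (auto simp: f_def L_def abs_mult)
    fix n
    have "\<forall>\<^sub>F N in sequentially.
        jacobi_term q z n * qbinomial q (N + N) (nat (int N + n)) = f N n"
      using eventually_ge_at_top[of "nat \<bar>n\<bar>"] by eventually_elim (auto simp: f_def)
    thus "(\<lambda>N. f N n) \<longlonglongrightarrow> jacobi_term q z n * (1 / L)"
      unfolding L_def
      by (rule Lim_transform_eventually[OF tendsto_mult[OF tendsto_const central_qbinomial_LIMSEQ]])
  qed
  moreover have "infsum (f N) UNIV = (\<Prod>i<N. 1 - z * q ^ i) * (\<Prod>i<N. 1 - q ^ Suc i / z)" for N
  proof -
    have "infsum (f N) UNIV = infsum (f N) {- int N..int N}"
      by (rule infsum_cong_neutral) (auto simp: f_def)
    thus ?thesis
      unfolding finite_jacobi_triple_product[OF q(1) z] by (simp add: f_def)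
  qed
  ultimately have "(\<lambda>N. (\<Prod>i<N. 1 - z * q ^ i) * (\<Prod>i<N. 1 - q ^ Suc i / z))
      \<longlonglongrightarrow> infsum (jacobi_term q z) UNIV * (1 / L)"
    by (simp only: infsum_cmult_left')
  from tendsto_mult[OF this qfact_LIMSEQ] \<open>L > 0\<close> show ?thesis
    by (simp add: L_def qfact_def)
qed

end

section \<open>Product expansions of theta functions\<close>

lemma range_arithmetic_progression:
  fixes r M :: nat
  assumes "0 < r" "r \<le> M"
  shows "range (\<lambda>i. M * i + r) = {n. 0 < n \<and> [n = r] (mod M)}"
proof (intro equalityI subsetI)
  fix n assume "n \<in> {n. 0 < n \<and> [n = r] (mod M)}"
  hence n: "0 < n" "n mod M = r mod M" by (auto simp: cong_def)
  show "n \<in> range (\<lambda>i. M * i + r)"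
  proof (cases "r = M")
    case True
    hence "M dvd n" using n by auto
    then obtain k where k: "n = M * k" by blast
    then obtain i where "k = Suc i" using n(1) by (cases k) auto
    thus ?thesis using True k by auto
  next
    case False
    hence "n = M * (n div M) + r"
      using n(2) assms by (metis mod_less le_neq_implies_less mult_div_mod_eq)
    thus ?thesis by blast
  qed
qed (use assms in \<open>auto simp: cong_def\<close>)

lemma pm_residue_class_zero: "pm_residue_class {0} (int M) = {n. 0 < n \<and> [n = M] (mod M)}"
  by (auto simp: pm_residue_class_def cong_def zmod_int[symmetric])

lemma pm_residue_class_singleton:
  assumes "r \<le> M"
  shows "pm_residue_class {int r} (int M)
    = {n. 0 < n \<and> [n = r] (mod M)} \<union> {n. 0 < n \<and> [n = M - r] (mod M)}"
proof -
  have "[int n = - int r] (mod int M) \<longleftrightarrow> [int n = int (M - r)] (mod int M)" for n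
    using assms by (simp add: cong_def of_nat_diff)
  thus ?thesis by (auto simp: pm_residue_class_def cong_int_iff)
qed

lemma pm_residue_class_insert:
  "pm_residue_class (insert r R) M = pm_residue_class {r} M \<union> pm_residue_class R M"
  by (auto simp: pm_residue_class_def)

lemma pm_residue_class_disjoint:
  assumes "r \<notin> R" and bounds: "\<And>s. s \<in> insert r R \<Longrightarrow> 0 \<le> s \<and> 2 * s < M"
  shows "pm_residue_class {r} M \<inter> pm_residue_class R M = {}"
proof -
  have "s = r" if s: "s \<in> R" and n: "[n = r] (mod M) \<or> [n = - r] (mod M)"
      "[n = s] (mod M) \<or> [n = - s] (mod M)" for n s
  proof -
    have "[r = s] (mod M) \<or> [r = - s] (mod M)"
      using n by (metis cong_minus_minus_iff cong_sym cong_trans minus_minus)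
    hence "M dvd (r - s) \<or> M dvd (r + s)"
      by (simp add: cong_iff_dvd_diff)
    moreover have "\<bar>r - s\<bar> < \<bar>M\<bar>" "\<bar>r + s\<bar> < \<bar>M\<bar>"
      using bounds[of r] bounds[of s] s by auto
    ultimately have "r - s = 0 \<or> r + s = 0"
      by (metis dvd_imp_le_int not_le)
    thus ?thesis using bounds[of r] bounds[of s] s by auto
  qed
  thus ?thesis using assms(1) by (fastforce simp: pm_residue_class_def)
qed

lemma ex_cong_least_abs_residue:
  "\<exists>j\<le>h. [int m = int j] (mod int (2 * h + 1)) \<or> [int m = - int j] (mod int (2 * h + 1))"
proof (cases "m mod (2 * h + 1) \<le> h")
  case True
  thus ?thesis by (intro exI[of _ "m mod (2 * h + 1)"]) (simp add: cong_def zmod_int)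
next
  case False
  define k where "k = 2 * h + 1"
  have "m mod k < k" by (simp add: k_def)
  hence "[int m = - int (k - m mod k)] (mod int k)"
    by (simp add: of_nat_diff cong_def zmod_int)
  moreover have "k - m mod k \<le> h" using False by (simp add: k_def)
  ultimately show ?thesis unfolding k_def by blast
qed

lemma pm_residue_class_multiples:
  assumes "0 < d"
  shows "pm_residue_class ((\<lambda>j. int (d * j)) ` {0..h}) (int (d * (2 * h + 1)))
    = pm_residue_class {0} (int d)"
proof (intro equalityI subsetI)
  fix n assume "n \<in> pm_residue_class ((\<lambda>j. int (d * j)) ` {0..h}) (int (d * (2 * h + 1)))"
  then obtain j where "0 < n"
      and "[int n = int (d * j)] (mod int (d * (2 * h + 1)))
        \<or> [int n = - int (d * j)] (mod int (d * (2 * h + 1)))"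
    by (auto simp: pm_residue_class_def)
  hence "[int n = int (d * j)] (mod int d) \<or> [int n = - int (d * j)] (mod int d)"
    by (metis cong_modulus_mult of_nat_mult)
  hence "[int n = 0] (mod int d)" by (auto simp: cong_def mod_minus_eq)
  thus "n \<in> pm_residue_class {0} (int d)"
    using \<open>0 < n\<close> by (simp add: pm_residue_class_def)
next
  fix n assume "n \<in> pm_residue_class {0} (int d)"
  then obtain m where n: "0 < n" "n = d * m"
    by (auto simp: pm_residue_class_zero cong_def)
  define k where "k = 2 * h + 1"
  obtain j where "j \<le> h" "[int m = int j] (mod int k) \<or> [int m = - int j] (mod int k)"
    using ex_cong_least_abs_residue[of h m] unfolding k_def by blast
  hence "[int n = int (d * j)] (mod int (d * k)) \<or> [int n = - int (d * j)] (mod int (d * k))"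
    using assms n(2)
    by (auto simp: cong_iff_dvd_diff right_diff_distrib[symmetric] distrib_left[symmetric])
  thus "n \<in> pm_residue_class ((\<lambda>j. int (d * j)) ` {0..h}) (int (d * (2 * h + 1)))"
    using n(1) \<open>j \<le> h\<close> by (fastforce simp: pm_residue_class_def k_def)
qed

lemma sum_squares_linear:
  "(\<Sum>j\<in>{1..m}. (2 * real j - c)\<^sup>2)
    = 2 * real m * (real m + 1) * (2 * real m + 1) / 3 - 2 * c * real m * (real m + 1)
      + real m * c\<^sup>2"
  by (induction m) (auto simp: power2_eq_square field_simps)

definition gen_eta :: "real \<Rightarrow> real \<Rightarrow> real \<Rightarrow> real" where
  "gen_eta q p r = theta q p r / eta q p"

definition gen_eta_exponent :: "real \<Rightarrow> real \<Rightarrow> real" where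
  "gen_eta_exponent p r = (r - p / 2)\<^sup>2 / (2 * p) - p / 24"

lemma sum_gen_eta_exponent_multiples:
  fixes d h :: nat
  assumes d: "0 < d"
  defines "M \<equiv> real (d * (2 * h + 1))"
  shows "(\<Sum>j\<in>{1..h}. gen_eta_exponent M (real (d * j))) = real d / 24 - M / 24"
proof -
  define c where "c = 2 * real h + 1"
  have c: "c > 0" "M = real d * c" by (simp_all add: c_def M_def algebra_simps)
  have "gen_eta_exponent (M) (real (d * j))
      = real d / (8 * c) * (2 * real j - c)\<^sup>2 - M / 24" for j
    using d c(1) by (simp add: gen_eta_exponent_def c(2) power2_eq_square field_simps)
  hence "(\<Sum>j\<in>{1..h}. gen_eta_exponent (M) (real (d * j)))
      = real d / (8 * c) * (\<Sum>j\<in>{1..h}. (2 * real j - c)\<^sup>2) - real h * M / 24"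
    by (simp only: sum_subtractf sum_distrib_left[symmetric]) simp
  also have "\<dots> = real d / 8 * (2 * real h * (real h + 1) / 3 - 2 * real h * (real h + 1)
        + real h * c) - real h * M / 24"
    using c(1) unfolding sum_squares_linear c_def[symmetric]
    by (simp add: power2_eq_square field_simps)
  also have "\<dots> = real d / 24 - M / 24"
    by (simp add: c(2) c_def field_simps)
  finally show ?thesis .
qed

lemma gen_eta_minus: "gen_eta q p (- r) = - gen_eta q p r"
  by (simp add: gen_eta_def theta_minus)

lemma gen_eta_add_period: "gen_eta q p (r + p) = - gen_eta q p r"
  by (simp add: gen_eta_def theta_add_period)

context
  fixes q :: real
  assumes q: "0 < q" "q < 1"
begin

lemma qprod_pm_residue_class:
  assumes "finite R" "\<And>r. r \<in> R \<Longrightarrow> 0 \<le> r \<and> 2 * r < M"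
  shows "qprod q (pm_residue_class R M) = (\<Prod>r\<in>R. qprod q (pm_residue_class {r} M))"
  using assms
proof (induction R rule: finite_induct)
  case empty
  show ?case by (simp add: qprod_def pm_residue_class_def)
next
  case (insert r R)
  have "pm_residue_class {r} M \<inter> pm_residue_class R M = {}"
    using insert.hyps insert.prems by (intro pm_residue_class_disjoint)
  thus ?case
    using insert
    by (simp add: pm_residue_class_insert[of _ R] qprod_Un[OF q] zero_notin_pm_residue_class)
qed

lemma jacobi_triple_product_qprod:
  assumes r: "0 < r" "r < M" "2 * r \<noteq> M"
  shows "infsum (jacobi_term (q ^ M) (q ^ r)) UNIV
    = qprod q (pm_residue_class {int r} (int M)) * qprod q (pm_residue_class {0} (int M))"
proof -
  define progression where "progression s = {n. 0 < n \<and> [n = s] (mod M)}" for s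
  have progression_LIMSEQ: "(\<lambda>N. \<Prod>i<N. 1 - q ^ (M * i + s)) \<longlonglongrightarrow> qprod q (progression s)"
    if "0 < s" "s \<le> M" for s
    using qprod_range_LIMSEQ[OF q, of "\<lambda>i. M * i + s"] range_arithmetic_progression[OF that] that
    by (simp add: strict_mono_def progression_def)
  have "progression r \<inter> progression (M - r) = {}"
    using r by (auto simp: progression_def cong_def)
  hence "qprod q (progression r) * qprod q (progression (M - r))
      = qprod q (pm_residue_class {int r} (int M))"
    using pm_residue_class_singleton[of r M] r
      qprod_Un[OF q, of "progression r" "progression (M - r)"]
    by (simp add: progression_def)
  moreover have "progression M = pm_residue_class {0} (int M)"
    by (simp add: pm_residue_class_zero progression_def)
  moreover have "0 < q ^ M" "q ^ M < 1" "0 < q ^ r"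
    using q r by (auto simp: power_less_one_iff)
  from jacobi_triple_product_LIMSEQ[OF this]
  have "(\<lambda>N. (\<Prod>i<N. 1 - q ^ (M * i + r)) * (\<Prod>i<N. 1 - q ^ (M * i + (M - r)))
      * (\<Prod>i<N. 1 - q ^ (M * i + M))) \<longlonglongrightarrow> infsum (jacobi_term (q ^ M) (q ^ r)) UNIV"
    using q r by (simp add: power_add power_mult[symmetric] power_diff mult_ac)
  ultimately show ?thesis
    using LIMSEQ_unique tendsto_mult[OF tendsto_mult[OF progression_LIMSEQ[of r]
          progression_LIMSEQ[of "M - r"]] progression_LIMSEQ[of M]] r
    by force
qed

theorem theta_eq_qprod:
  assumes r: "0 < r" "r < M" "2 * r \<noteq> M"
  shows "theta q (real M) (real r) = q powr ((real r - real M / 2)\<^sup>2 / (2 * real M))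
    * (qprod q (pm_residue_class {int r} (int M)) * qprod q (pm_residue_class {0} (int M)))"
proof -
  define e where "e = (real r - real M / 2)\<^sup>2 / (2 * real M)"
  have "theta_term q (real M) (real r) = (\<lambda>n. q powr e * jacobi_term (q ^ M) (q ^ r) n)"
  proof
    fix n
    have "theta_exponent (real M) (real r - real M / 2) n
        = e + real M * (of_int n * (of_int n - 1) / 2) + real r * of_int n"
      using r by (simp add: e_def theta_exponent_def power2_eq_square field_simps)
    thus "theta_term q (real M) (real r) n = q powr e * jacobi_term (q ^ M) (q ^ r) n"
      using q
      by (simp add: theta_term_def jacobi_term_def powr_add powr_powr[symmetric] powr_realpow
          del: times_divide_eq_right)
  qed
  thus ?thesis
    using jacobi_triple_product_qprod[OF r]
    by (simp add: theta_def e_def[symmetric] infsum_cmult_right')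
qed

lemma theta_nonzero:
  assumes "0 < r" "r < M" "2 * r \<noteq> M"
  shows "theta q (real M) (real r) \<noteq> 0"
  unfolding theta_eq_qprod[OF assms]
  using q qprod_pos[OF q zero_notin_pm_residue_class] by (auto simp: less_imp_neq[THEN not_sym])

theorem eta_eq_qprod:
  assumes "0 < M"
  shows "eta q (real M) = q powr (real M / 24) * qprod q (pm_residue_class {0} (int M))"
proof -
  have exponent: "(real M - real (3 * M) / 2)\<^sup>2 / (2 * real (3 * M)) = real M / 24"
    using assms by (simp add: power2_eq_square field_simps)
  have "qprod q (pm_residue_class {0, int M} (int (3 * M)))
      = (\<Prod>r\<in>{0, int M}. qprod q (pm_residue_class {r} (int (3 * M))))"
    using assms by (intro qprod_pm_residue_class) auto
  moreover have "pm_residue_class {0, int M} (int (3 * M)) = pm_residue_class {0} (int M)"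
    using pm_residue_class_multiples[OF assms, of 1]
    by (simp add: mult.commute atLeast0AtMost atMost_Suc insert_commute)
  ultimately show ?thesis
    using theta_eq_qprod[of M "3 * M", unfolded exponent] assms by (simp add: eta_def)
qed

lemma eta_nonzero: "0 < M \<Longrightarrow> eta q (real M) \<noteq> 0"
  using q qprod_pos[OF q zero_notin_pm_residue_class, of "{0}" "int M"]
  by (simp add: eta_eq_qprod)

lemma gen_eta_nonzero:
  assumes "\<not> int M dvd 2 * n" "0 < M"
  shows "gen_eta q (real M) (of_int n) \<noteq> 0"
proof -
  define r where "r = nat (n mod int M)"
  have r: "int r = n mod int M" using assms by (simp add: r_def)
  have "n = int r + n div int M * int M" by (simp add: r)
  hence "real_of_int n = real r + of_int (n div int M) * real M"
    by (metis of_int_add of_int_mult of_int_of_nat_eq)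
  hence "\<bar>theta q (real M) (of_int n)\<bar> = \<bar>theta q (real M) (real r)\<bar>"
    using theta_add_int_period[of q "real M" "real r" "n div int M"]
    by (cases "even (n div int M)") simp_all
  moreover have "0 < r" "r < M" "2 * r \<noteq> M"
  proof -
    show "r < M" using r assms(2) by (metis of_nat_0_less_iff of_nat_less_iff pos_mod_bound)
    have "\<not> int M dvd 2 * int r"
      using assms(1) by (metis r dvd_eq_mod_eq_0 mod_mult_right_eq)
    thus "2 * r \<noteq> M" "0 < r" by (auto intro: gr0I)
  qed
  ultimately show ?thesis
    using theta_nonzero[of r M] eta_nonzero[OF assms(2)] by (auto simp: gen_eta_def)
qed

lemma three_term_gen_eta: "p > 0 \<Longrightarrow> three_term (gen_eta q p) x y u v = 0"
proof -
  have "three_term (gen_eta q p) x y u v = three_term (theta q p) x y u v / eta q p ^ 4"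
    by (simp add: three_term_def gen_eta_def power4_eq_xxxx add_divide_distrib diff_divide_distrib)
  thus "p > 0 \<Longrightarrow> ?thesis" using three_term_theta[OF q, of p] by simp
qed

lemma prod_gen_eta:
  assumes R: "finite R" "\<And>r. r \<in> R \<Longrightarrow> 0 < r \<and> 2 * r < int M"
  shows "(\<Prod>r\<in>R. gen_eta q (real M) (of_int r))
    = q powr (\<Sum>r\<in>R. gen_eta_exponent (real M) (of_int r)) * qprod q (pm_residue_class R (int M))"
proof -
  have "gen_eta q (real M) (of_int r)
      = q powr gen_eta_exponent (real M) (of_int r) * qprod q (pm_residue_class {r} (int M))"
    if r: "r \<in> R" for r
  proof -
    obtain s where s: "r = int s" using R(2)[OF r] by (metis zero_less_imp_eq_int)
    hence "0 < s" "s < M" "2 * s \<noteq> M" "0 < M" using R(2)[OF r] by auto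
    thus ?thesis
      using qprod_pos[OF q zero_notin_pm_residue_class, of "{0}" "int M"]
      by (simp add: s gen_eta_def theta_eq_qprod eta_eq_qprod gen_eta_exponent_def powr_diff)
  qed
  hence "(\<Prod>r\<in>R. gen_eta q (real M) (of_int r))
      = (\<Prod>r\<in>R. q powr gen_eta_exponent (real M) (of_int r))
        * (\<Prod>r\<in>R. qprod q (pm_residue_class {r} (int M)))"
    by (simp add: prod.distrib)
  also have "(\<Prod>r\<in>R. qprod q (pm_residue_class {r} (int M))) = qprod q (pm_residue_class R (int M))"
    using R by (intro qprod_pm_residue_class[symmetric]) (auto intro: less_imp_le)
  also have "(\<Prod>r\<in>R. q powr gen_eta_exponent (real M) (of_int r))
      = q powr (\<Sum>r\<in>R. gen_eta_exponent (real M) (of_int r))"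
    using q by (simp add: powr_sum)
  finally show ?thesis .
qed

theorem prod_gen_eta_multiples:
  fixes d h :: nat
  assumes d: "0 < d"
  defines "M \<equiv> d * (2 * h + 1)"
  shows "(\<Prod>j\<in>{1..h}. gen_eta q (real M) (real (d * j))) = eta q (real d) / eta q (real M)"
proof -
  have M: "0 < M" using d by (simp add: M_def)
  define R where "R = (\<lambda>j. int (d * j)) ` {1..h}"
  have R: "0 < r \<and> 2 * r < int M" if r: "r \<in> R" for r
  proof -
    from r obtain j where j: "j \<in> {1..h}" "r = int (d * j)"
      unfolding R_def by (elim imageE) simp
    hence "d * (2 * j) < M" using d by (simp only: M_def mult_less_cancel1) simp
    moreover have "0 < d * j" using j d by simp
    moreover have "2 * (d * j) = d * (2 * j)" by simp
    ultimately have "0 < int (d * j)" "int (2 * (d * j)) < int M"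
      by (simp_all only: of_nat_less_iff of_nat_0_less_iff)
    thus ?thesis by (simp add: j(2))
  qed
  have inj: "inj_on (\<lambda>j. int (d * j)) {1..h}"
    using d by (auto simp: inj_on_def)
  have "{0..h} = insert 0 {1..h}" by auto
  hence "pm_residue_class {0} (int d) = pm_residue_class (insert 0 R) (int M)"
    using pm_residue_class_multiples[OF d, of h] by (simp add: M_def R_def)
  hence "pm_residue_class {0} (int d) = pm_residue_class {0} (int M) \<union> pm_residue_class R (int M)"
    by (simp only: pm_residue_class_insert[of 0 R])
  moreover have "pm_residue_class {0} (int M) \<inter> pm_residue_class R (int M) = {}"
    using R M by (intro pm_residue_class_disjoint) (auto dest: less_imp_le)
  ultimately have "qprod q (pm_residue_class {0} (int d))
      = qprod q (pm_residue_class {0} (int M)) * qprod q (pm_residue_class R (int M))"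
    by (simp add: qprod_Un[OF q] zero_notin_pm_residue_class)
  moreover have "(\<Prod>j\<in>{1..h}. gen_eta q (real M) (real (d * j)))
      = (\<Prod>r\<in>R. gen_eta q (real M) (of_int r))"
    unfolding R_def by (simp only: prod.reindex[OF inj] o_def of_int_of_nat_eq)
  moreover have "(\<Sum>r\<in>R. gen_eta_exponent (real M) (of_int r)) = real d / 24 - real M / 24"
    unfolding R_def by (simp only: sum.reindex[OF inj] o_def of_int_of_nat_eq M_def)
      (rule sum_gen_eta_exponent_multiples[OF d])
  ultimately show ?thesis
    using prod_gen_eta[OF _ R] qprod_pos[OF q zero_notin_pm_residue_class, of "{0}" "int M"]
    by (simp add: R_def eta_eq_qprod d M powr_diff)
qed

lemma gen_eta_dissection_5:
  assumes p: "0 < p"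
  defines "t \<equiv> gen_eta q (25 * real p)"
  shows "eta q (real p) / eta q (25 * real p) * (t (5 * real p) * t (10 * real p))
    = (t (10 * real p))\<^sup>2 - t (5 * real p) * t (10 * real p) - (t (5 * real p))\<^sup>2"
proof -
  define c where "c = eta q (25 * real p)"
  define x where "x = theta q (25 * real p) (5 * real p)"
  define y where "y = theta q (25 * real p) (10 * real p)"
  have c: "c \<noteq> 0" using eta_nonzero[of "25 * p"] p by (simp add: c_def)
  have "eta q (real p) / c * (x / c * (y / c)) = eta q (real p) * (x * y) / c ^ 3"
    by (simp add: power3_eq_cube)
  also have "eta q (real p) * (x * y) = c * (y\<^sup>2 - x * y - x\<^sup>2)"
    using eta_dissection_5[OF q, of "real p"] p by (simp add: c_def x_def y_def)
  also have "\<dots> / c ^ 3 = (y / c)\<^sup>2 - x / c * (y / c) - (x / c)\<^sup>2"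
    using c by (simp add: power2_eq_square power3_eq_cube diff_divide_distrib)
  finally show ?thesis by (simp add: t_def gen_eta_def c_def x_def y_def)
qed

end

section \<open>Relations of level 50\<close>

text \<open>Think of \<open>a k\<close> and \<open>b k\<close> as indexed modulo 5. The products \<open>b i * b j\<close> with \<open>i \<noteq> j\<close>, the
  products \<open>b i * g\<close> and \<open>g\<^sup>2\<close> are then polynomials in \<open>f\<close> and the \<open>a k\<close>.\<close>

locale cyclic_quadrics =
  fixes a b :: "nat \<Rightarrow> real" and f g :: real
  assumes a_period: "a (k + 5) = a k" and b_period: "b (k + 5) = b k"
    and a_mult_a: "a k * a (k + 2) = a (k + 3) * a (k + 4) + b (k + 2) * g"
    and a_mult_f: "a k * f = a (k + 3) * a (k + 4) - b (k + 2) * b (k + 4)"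
    and b_mult_b: "b k * b (k + 1) = b (k + 2) * (b (k + 4) + g)"
    and b_nonzero: "b k \<noteq> 0" and g_nonzero: "g \<noteq> 0"
begin

lemma period_numerals:
  "a 5 = a 0" "a 6 = a 1" "a 7 = a 2" "a 8 = a 3"
  "b 5 = b 0" "b 6 = b 1" "b 7 = b 2" "b 8 = b 3"
  using a_period[of 0] a_period[of 1] a_period[of 2] a_period[of 3]
    b_period[of 0] b_period[of 1] b_period[of 2] b_period[of 3]
  by (simp_all del: One_nat_def add_2_eq_Suc')

lemma b_mult_g:
  "a 0 * a 2 - a 3 * a 4 = b 2 * g"
  "a 1 * a 3 - a 4 * a 0 = b 3 * g"
  "a 2 * a 4 - a 0 * a 1 = b 4 * g"
  "a 3 * a 0 - a 1 * a 2 = b 0 * g"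
  "a 4 * a 1 - a 2 * a 3 = b 1 * g"
  using a_mult_a[of 0] a_mult_a[of 1] a_mult_a[of 2] a_mult_a[of 3] a_mult_a[of 4]
  by (simp_all add: period_numerals del: One_nat_def add_2_eq_Suc')

lemma b_mult_b_two_apart:
  "a 3 * a 4 - a 0 * f = b 2 * b 4"
  "a 4 * a 0 - a 1 * f = b 3 * b 0"
  "a 0 * a 1 - a 2 * f = b 4 * b 1"
  "a 1 * a 2 - a 3 * f = b 0 * b 2"
  "a 2 * a 3 - a 4 * f = b 1 * b 3"
  using a_mult_f[of 0] a_mult_f[of 1] a_mult_f[of 2] a_mult_f[of 3] a_mult_f[of 4]
  by (simp_all add: period_numerals del: One_nat_def add_2_eq_Suc')

lemma b_mult_b_adjacent:
  "a 0 * (a 2 - f) = b 0 * b 1"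
  "a 1 * (a 3 - f) = b 1 * b 2"
  "a 2 * (a 4 - f) = b 2 * b 3"
  "a 3 * (a 0 - f) = b 3 * b 4"
  "a 4 * (a 1 - f) = b 4 * b 0"
  using b_mult_b[of 0] b_mult_b[of 1] b_mult_b[of 2] b_mult_b[of 3] b_mult_b[of 4]
    b_mult_g b_mult_b_two_apart
  by (simp_all add: period_numerals algebra_simps del: One_nat_def add_2_eq_Suc')

lemma g_squared: "g\<^sup>2 = - (b 0 * b 1 + b 1 * b 2 + b 2 * b 3 + b 3 * b 4 + b 4 * b 0)"
proof -
  have "b 0 * g * (b 0 * b 1 + b 1 * b 2 + b 2 * b 3 + b 3 * b 4 + b 4 * b 0 + g\<^sup>2)
      = (b 0 * b 4 - b 0 * g) * (b 2 * (b 4 + g) - b 0 * b 1)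
        + (b 0 * b 2 + b 4 * g) * (b 3 * (b 0 + g) - b 1 * b 2)
        + (b 0)\<^sup>2 * (b 4 * (b 1 + g) - b 2 * b 3)
        + (b 1 * b 2 + g\<^sup>2) * (b 0 * (b 2 + g) - b 3 * b 4)
        + b 2 * b 4 * (b 1 * (b 3 + g) - b 4 * b 0)"
    by (simp add: algebra_simps power2_eq_square)
  also have "\<dots> = 0"
    using b_mult_b[of 0] b_mult_b[of 1] b_mult_b[of 2] b_mult_b[of 3] b_mult_b[of 4]
    by (simp add: period_numerals del: One_nat_def add_2_eq_Suc')
  finally show ?thesis
    using b_nonzero[of 0] g_nonzero by (simp add: eq_neg_iff_add_eq_0 add.commute)
qed

lemma g_squared_eq_a:
  "g\<^sup>2 = f * (a 0 + a 1 + a 2 + a 3 + a 4)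
    - (a 0 * a 2 + a 1 * a 3 + a 2 * a 4 + a 3 * a 0 + a 4 * a 1)"
  unfolding g_squared b_mult_b_adjacent[symmetric] by (simp add: algebra_simps)

text \<open>The coefficients in this proof and the next were found by linear algebra; every bracket
  vanishes because it expresses one product of four of the \<open>b k\<close> and \<open>g\<close> in two ways.\<close>

lemma f_mult_b_squared: "f * (b 3)\<^sup>2 = f * (a 1)\<^sup>2 - a 0 * f\<^sup>2 + a 0 * g\<^sup>2"
proof -
  have "f * ((a 4 * a 0 - a 1 * f) * (a 2 * a 3 - a 4 * f))
      - (a 0 * (a 2 - f)) * (f * (a 1)\<^sup>2 - a 0 * f\<^sup>2 + a 0 * g\<^sup>2)
    = - a 0 * (g\<^sup>2 * (a 0 * (a 2 - f)) - (a 3 * a 0 - a 1 * a 2) * (a 4 * a 1 - a 2 * a 3))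
      + f * ((a 4 * a 0 - a 1 * f) * (a 2 * a 4 - a 0 * a 1)
        - (a 4 * (a 1 - f)) * (a 1 * a 3 - a 4 * a 0))
      - a 3 * ((a 0 * (a 2 - f)) * (a 2 * a 4 - a 0 * a 1)
        - (a 0 * a 1 - a 2 * f) * (a 3 * a 0 - a 1 * a 2))
      + a 0 * ((a 1 * a 2 - a 3 * f) * (a 4 * a 1 - a 2 * a 3)
        - (a 1 * (a 3 - f)) * (a 3 * a 0 - a 1 * a 2))
      - f * ((a 4 * a 0 - a 1 * f) * (a 4 * a 1 - a 2 * a 3)
        - (a 2 * a 3 - a 4 * f) * (a 3 * a 0 - a 1 * a 2))
      + a 0 * ((a 2 * a 3 - a 4 * f) * (a 2 * a 4 - a 0 * a 1)
        - (a 3 * (a 0 - f)) * (a 4 * a 1 - a 2 * a 3))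
      - f * ((a 0 * (a 2 - f)) * (a 3 * a 4 - a 0 * f)
        - (a 4 * (a 1 - f)) * (a 1 * (a 3 - f)))"
    unfolding g_squared_eq_a by (simp add: algebra_simps power2_eq_square)
  also have "\<dots> = 0"
    unfolding b_mult_g b_mult_b_two_apart b_mult_b_adjacent by (simp add: power2_eq_square)
  finally have "b 0 * b 1 * (f * (b 3)\<^sup>2 - (f * (a 1)\<^sup>2 - a 0 * f\<^sup>2 + a 0 * g\<^sup>2)) = 0"
    unfolding b_mult_b_adjacent b_mult_b_two_apart by (simp add: algebra_simps power2_eq_square)
  thus ?thesis using b_nonzero by simp
qed

theorem f_b_minus_a_b_mult_g_squared:
  "b 0 * b 3 * g\<^sup>2 * (f * b 2 - a 2 * b 4)
    = - (a 0 * a 2 * a 3 * a 4 * f * (b 0 + b 1 + b 2 + b 3 + b 4))"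
  (is "?lhs = - ?rhs")
proof -
  have "b 3 * (?lhs + ?rhs) = b 3 * b 0 * (f * (b 2 * b 3) - a 2 * (b 3 * b 4)) * g\<^sup>2
      + a 0 * a 2 * a 3 * a 4
        * (f * (b 3)\<^sup>2 + f * (b 3 * b 0 + b 1 * b 3 + b 2 * b 3 + b 3 * b 4))"
    by (simp add: algebra_simps power2_eq_square)
  also have "\<dots> = (a 4 * a 0 - a 1 * f) * (f * (a 2 * (a 4 - f)) - a 2 * (a 3 * (a 0 - f))) * g\<^sup>2
      + a 0 * a 2 * a 3 * a 4 * ((f * (a 1)\<^sup>2 - a 0 * f\<^sup>2 + a 0 * g\<^sup>2)
        + f * ((a 4 * a 0 - a 1 * f) + (a 2 * a 3 - a 4 * f) + (a 2 * (a 4 - f))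
          + (a 3 * (a 0 - f))))"
    unfolding f_mult_b_squared b_mult_b_adjacent b_mult_b_two_apart by (simp add: mult_ac)
  also have "\<dots> = a 2 * f *
      ((a 4 - f) * (g\<^sup>2 * (a 4 * a 0 - a 1 * f) - (a 3 * a 0 - a 1 * a 2) * (a 1 * a 3 - a 4 * a 0))
      + a 1 * (g\<^sup>2 * (a 3 * (a 0 - f)) - (a 1 * a 3 - a 4 * a 0) * (a 2 * a 4 - a 0 * a 1))
      + a 3 * ((a 0 * (a 2 - f)) * (a 1 * a 3 - a 4 * a 0)
        - (a 4 * a 0 - a 1 * f) * (a 4 * a 1 - a 2 * a 3))
      - a 1 * ((a 0 * a 1 - a 2 * f) * (a 1 * a 3 - a 4 * a 0)
        - (a 3 * (a 0 - f)) * (a 4 * a 1 - a 2 * a 3)))"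
    unfolding g_squared_eq_a by (simp add: algebra_simps power2_eq_square)
  also have "\<dots> = 0"
    unfolding b_mult_g b_mult_b_two_apart b_mult_b_adjacent by (simp add: power2_eq_square)
  finally show ?thesis using b_nonzero[of 3] by (simp add: eq_neg_iff_add_eq_0)
qed

end

locale theta_50 =
  fixes t :: "int \<Rightarrow> real"
  assumes minus: "t (- n) = - t n"
    and add_period: "t (n + 50) = - t n"
    and three_term: "three_term t x y u v = 0"
    and nonzero: "\<not> 25 dvd n \<Longrightarrow> t n \<noteq> 0"
    and dissection: "(\<Prod>n\<in>{2, 4, 6, 8, 10, 12, 14, 16, 18, 20, 22, 24}. t n) * (t 10 * t 20)
      = (t 20)\<^sup>2 - t 10 * t 20 - (t 10)\<^sup>2"
begin

lemma add_period_mult: "t (n + 50 * int m) = (-1) ^ m * t n"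
proof (induction m)
  case (Suc m)
  thus ?case using add_period[of "n + 50 * int m"] by (simp add: algebra_simps)
qed simp

lemma reduce_mod_50:
  assumes "25 < n"
  shows "t n = (-1) ^ nat ((n + 25) div 50) * t (n - 50 * ((n + 25) div 50))"
  using add_period_mult[of "n - 50 * ((n + 25) div 50)" "nat ((n + 25) div 50)"] assms
  by (simp add: pos_imp_zdiv_nonneg_iff)

lemma theta_50_mult_3: "theta_50 (\<lambda>n. t (3 * n))"
proof
  show "t (3 * - n) = - t (3 * n)" for n
    using minus[of "3 * n"] by simp
  show "t (3 * (n + 50)) = - t (3 * n)" for n
    using add_period_mult[of "3 * n" 3] by (simp add: algebra_simps)
  show "three_term (\<lambda>n. t (3 * n)) x y u v = 0" for x y u v
    using three_term[of "3 * x" "3 * y" "3 * u" "3 * v"]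
    by (simp add: three_term_def distrib_left right_diff_distrib)
  show "t (3 * n) \<noteq> 0" if "\<not> 25 dvd n" for n
    using that by (intro nonzero) presburger
  show "(\<Prod>n\<in>{2, 4, 6, 8, 10, 12, 14, 16, 18, 20, 22, 24}. t (3 * n)) * (t (3 * 10) * t (3 * 20))
      = (t (3 * 20))\<^sup>2 - t (3 * 10) * t (3 * 20) - (t (3 * 10))\<^sup>2"
    using dissection by (simp add: reduce_mod_50 minus mult_ac)
qed

lemma theta_50_mult_power_3: "theta_50 (\<lambda>n. t (3 ^ k * n))"
proof (induction k)
  case 0
  show ?case using theta_50_axioms by simp
next
  case (Suc k)
  show ?case using theta_50.theta_50_mult_3[OF Suc] by (simp add: mult_ac)
qed

text \<open>Since \<open>3 ^ 5\<close> is \<open>- 7\<close> modulo 50, \<open>a\<close> and \<open>b\<close> have period 5; the sign in \<open>b\<close> compensates for the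
  antiperiodicity of \<open>t\<close>.\<close>

definition a :: "nat \<Rightarrow> real" where "a k = t (3 ^ k) * t (3 ^ k * 7)"
definition b :: "nat \<Rightarrow> real" where "b k = (-1) ^ k * (t (3 ^ k * 2) * t (3 ^ k * 14))"
definition f :: real where "f = t 5 * t 15"
definition g :: real where "g = t 10 * t 20"

lemma base_quadrics:
  "a 0 * a 2 = a 3 * a 4 + b 2 * g"
  "a 0 * f = a 3 * a 4 - b 2 * b 4"
  "b 0 * b 1 = b 2 * (b 4 + g)"
  using three_term[of 24 17 7 6] three_term[of 24 19 8 7] three_term[of 24 18 8 6]
  by (simp_all add: three_term_def a_def b_def f_def g_def reduce_mod_50 minus algebra_simps)

lemma f_mult_power_3: "t (3 ^ k * 5) * t (3 ^ k * 15) = f"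
proof (induction k)
  case (Suc k)
  interpret scaled: theta_50 "\<lambda>n. t (3 ^ k * n)" by (rule theta_50_mult_power_3)
  have "t (3 ^ k * 45) = t (3 ^ k * 5)" using scaled.reduce_mod_50[of 45] scaled.minus[of 5] by simp
  thus ?case using Suc by (simp add: mult_ac)
qed (simp add: f_def)

lemma g_mult_power_3: "t (3 ^ k * 10) * t (3 ^ k * 20) = (-1) ^ k * g"
proof (induction k)
  case (Suc k)
  interpret scaled: theta_50 "\<lambda>n. t (3 ^ k * n)" by (rule theta_50_mult_power_3)
  have "t (3 ^ k * 60) = - t (3 ^ k * 10)" "t (3 ^ k * 30) = t (3 ^ k * 20)"
    using scaled.reduce_mod_50[of 60] scaled.reduce_mod_50[of 30] scaled.minus[of 20] by simp_all
  thus ?case using Suc by (simp add: mult_ac)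
qed (simp add: g_def)

sublocale quadrics: cyclic_quadrics a b f g
proof
  fix k
  interpret scaled: theta_50 "\<lambda>n. t (3 ^ k * n)" by (rule theta_50_mult_power_3)
  have a: "scaled.a j = a (k + j)" for j
    unfolding scaled.a_def a_def by (simp add: power_add mult_ac)
  have b: "scaled.b j = (-1) ^ k * b (k + j)" for j
    unfolding scaled.b_def b_def by (simp add: power_add mult_ac)
  have f: "scaled.f = f" and g: "scaled.g = (-1) ^ k * g"
    unfolding scaled.f_def scaled.g_def f_mult_power_3 g_mult_power_3 by simp_all
  have sign: "(-1) ^ k * x * ((-1) ^ k * y) = x * y" for x y :: real
    by (simp add: power_mult_distrib[symmetric] mult.left_commute[of _ x] flip: mult.assoc)
  note base = scaled.base_quadrics[unfolded a b f g sign distrib_left[symmetric]]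
  show "a k * a (k + 2) = a (k + 3) * a (k + 4) + b (k + 2) * g"
    and "a k * f = a (k + 3) * a (k + 4) - b (k + 2) * b (k + 4)"
    and "b k * b (k + 1) = b (k + 2) * (b (k + 4) + g)"
    using base by simp_all
  have "scaled.a 5 = scaled.a 0" "scaled.b 5 = scaled.b 0"
    unfolding scaled.a_def scaled.b_def by (simp_all add: scaled.reduce_mod_50 minus)
  thus "a (k + 5) = a k" "b (k + 5) = b k"
    by (simp_all add: a b)
  show "b k \<noteq> 0" using scaled.nonzero[of 2] scaled.nonzero[of 14] by (simp add: b_def)
  show "g \<noteq> 0" using nonzero[of 10] nonzero[of 20] by (simp add: g_def)
qed

lemma sum_b: "b 0 + b 1 + b 2 + b 3 + b 4 = (t 20)\<^sup>2 - t 10 * t 20 - (t 10)\<^sup>2"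
proof -
  have "t 6 * t 18 * t 20
      * (b 0 + b 1 + b 2 + b 3 + b 4 - ((t 20)\<^sup>2 - t 10 * t 20 - (t 10)\<^sup>2))
    = - t 22 * three_term t 24 14 10 4 + t 24 * three_term t 24 16 12 4
      + t 18 * three_term t 24 16 10 6 - t 6 * three_term t 24 16 12 6
      + (t 10 - t 20) * three_term t 24 18 12 6 - t 10 * three_term t 21 13 11 7
      + t 8 * three_term t 22 16 12 8 - t 12 * three_term t 24 18 12 8
      + t 14 * three_term t 19 13 11 9"
    by (simp add: b_def reduce_mod_50 minus three_term_def algebra_simps power2_eq_square)
  thus ?thesis using nonzero[of 6] nonzero[of 18] nonzero[of 20] by (simp add: three_term)
qed

lemma sum_b_eq_prod_b: "b 0 + b 1 + b 2 + b 3 + b 4 = - (b 0 * b 1 * b 2 * b 3 * b 4 * g\<^sup>2)"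
  using dissection unfolding sum_b[symmetric]
  by (simp add: b_def g_def reduce_mod_50 minus power2_eq_square mult_ac)

theorem f_b_minus_a_b_eq_prod:
  "f * b 2 - a 2 * b 4 = a 0 * a 2 * a 3 * a 4 * f * b 1 * b 2 * b 4"
proof -
  have "b 0 * b 3 * g\<^sup>2 * (f * b 2 - a 2 * b 4)
      = b 0 * b 3 * g\<^sup>2 * (a 0 * a 2 * a 3 * a 4 * f * b 1 * b 2 * b 4)"
    unfolding quadrics.f_b_minus_a_b_mult_g_squared sum_b_eq_prod_b by (simp add: mult_ac)
  thus ?thesis using quadrics.b_nonzero quadrics.g_nonzero by simp
qed

lemma theta_difference_eq_prod:
  "t 5 * t 15 * t 18 * t 24 - t 9 * t 12 * t 13 * t 16
    = (\<Prod>n\<in>{1, 5, 6, 7, 8, 9, 11, 12, 13, 15, 16, 17, 18, 19, 23, 24}. t n)"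
  using f_b_minus_a_b_eq_prod by (simp add: a_def b_def f_def reduce_mod_50 minus mult_ac)

theorem reciprocal_relations:
  "1 / (\<Prod>n\<in>{1, 6, 7, 8, 9, 11, 12, 13, 16, 17, 19, 23}. t n)
    = 1 / (\<Prod>n\<in>{1, 5, 6, 7, 8, 11, 15, 17, 18, 19, 23, 24}. t n) + 1"
  "1 / (\<Prod>n\<in>{1, 3, 4, 5, 7, 15, 17, 18, 19, 21, 22, 24}. t n)
    = 1 / (\<Prod>n\<in>{1, 2, 3, 7, 11, 14, 17, 18, 19, 21, 23, 24}. t n) + 1"
  "1 / (\<Prod>n\<in>{1, 3, 4, 5, 7, 9, 12, 13, 15, 16, 21, 22}. t n)
    = 1 / (\<Prod>n\<in>{1, 3, 4, 6, 7, 8, 9, 13, 17, 19, 21, 22}. t n) + 1"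
  "1 / (\<Prod>n\<in>{2, 3, 5, 9, 11, 12, 13, 14, 15, 16, 21, 23}. t n)
    = 1 / (\<Prod>n\<in>{1, 3, 7, 9, 11, 12, 13, 16, 18, 21, 23, 24}. t n) + 1"
  "1 / (\<Prod>n\<in>{2, 5, 6, 8, 9, 11, 13, 14, 15, 17, 19, 23}. t n)
    = 1 / (\<Prod>n\<in>{2, 3, 4, 9, 11, 13, 14, 17, 19, 21, 22, 23}. t n) + 1"
proof goal_cases
  note scaled = theta_50.theta_difference_eq_prod[OF theta_50_mult_power_3]
  note rules = reduce_mod_50 minus nonzero field_simps
  case 1 show ?case using scaled[of 0] by (simp add: rules)
  case 2 show ?case using scaled[of 1] by (simp add: rules)
  case 3 show ?case using scaled[of 2] by (simp add: rules)
  case 4 show ?case using scaled[of 3] by (simp add: rules)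
  case 5 show ?case using scaled[of 4] by (simp add: rules)
qed

end

lemma theta_50_gen_eta:
  assumes q: "0 < q" "q < 1"
  shows "theta_50 (\<lambda>n. gen_eta q 50 (of_int n))"
proof
  fix n x y u v :: int
  show "gen_eta q 50 (of_int (- n)) = - gen_eta q 50 (of_int n)"
    by (simp add: gen_eta_minus)
  show "gen_eta q 50 (of_int (n + 50)) = - gen_eta q 50 (of_int n)"
    using gen_eta_add_period[of q 50 "of_int n"] by simp
  show "three_term (\<lambda>n. gen_eta q 50 (of_int n)) x y u v = 0"
    using three_term_gen_eta[OF q, of 50 "of_int x" "of_int y" "of_int u" "of_int v"]
    by (simp add: three_term_def)
  show "gen_eta q 50 (of_int n) \<noteq> 0" if "\<not> 25 dvd n"
  proof -
    have "\<not> 50 dvd 2 * n" using that by presburger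
    thus ?thesis using gen_eta_nonzero[OF q, of 50 n] by simp
  qed
  have "(\<Prod>n\<in>{2, 4, 6, 8, 10, 12, 14, 16, 18, 20, 22, 24}. gen_eta q 50 (of_int n))
      = (\<Prod>j\<in>{1..12}. gen_eta q 50 (real (2 * j)))"
    by (simp add: prod.atLeast1_atMost_eq lessThan_nat_numeral)
  also have "\<dots> = eta q 2 / eta q 50"
    using prod_gen_eta_multiples[OF q, of 2 12] by simp
  finally show "(\<Prod>n\<in>{2, 4, 6, 8, 10, 12, 14, 16, 18, 20, 22, 24}. gen_eta q 50 (of_int n))
      * (gen_eta q 50 (of_int 10) * gen_eta q 50 (of_int 20))
    = (gen_eta q 50 (of_int 20))\<^sup>2 - gen_eta q 50 (of_int 10) * gen_eta q 50 (of_int 20)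
      - (gen_eta q 50 (of_int 10))\<^sup>2"
    using gen_eta_dissection_5[OF q, of 2] by (simp only:) simp
qed

section \<open>Generating functions of partitions\<close>

lemma num_partitions_insert:
  assumes "m \<notin> S" "0 \<notin> S" "0 < m"
  shows "num_partitions (insert m S) n
    = num_partitions S n + (if m \<le> n then num_partitions (insert m S) (n - m) else 0)"
proof -
  define X where "X A k = {P :: nat multiset. set_mset P \<subseteq> A \<and> sum_mset P = k}" for A k
  define Y where "Y = {P \<in> X (insert m S) n. m \<in># P}"
  have finite: "finite (X (insert m S) n)"
    unfolding X_def using assms by (intro finite_partitions) auto
  have split: "X (insert m S) n = X S n \<union> Y"
    by (auto simp: X_def Y_def)
  have "card (X (insert m S) n) = card (X S n) + card Y"
    unfolding split
  proof (rule card_Un_disjoint)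
    show "finite (X S n)" "finite Y" using finite unfolding split by simp_all
    show "X S n \<inter> Y = {}" using assms by (auto simp: X_def Y_def)
  qed
  moreover have "Y = (if m \<le> n then add_mset m ` X (insert m S) (n - m) else {})"
  proof -
    have "P \<in> add_mset m ` X (insert m S) (n - m) \<and> m \<le> n" if P: "P \<in> Y" for P
    proof -
      from P have "m \<in># P" by (simp add: Y_def)
      then obtain P' where "P = add_mset m P'" by (blast dest: multi_member_split)
      thus ?thesis using P by (auto simp: X_def Y_def)
    qed
    thus ?thesis by (auto simp: X_def Y_def)
  qed
  moreover have "card (add_mset m ` Z) = card Z" for Z
    by (rule card_image) (auto simp: inj_on_def)
  ultimately show ?thesis
    by (simp add: X_def num_partitions_def)
qed

lemma sums_shift_iff:
  fixes f :: "nat \<Rightarrow> real"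
  shows "(\<lambda>n. if m \<le> n then f (n - m) else 0) sums s \<longleftrightarrow> f sums s"
  using sums_iff_shift[of "\<lambda>n. if m \<le> n then f (n - m) else 0" m s] by simp

lemma sums_if_shift_recurrence:
  fixes a b :: "nat \<Rightarrow> real"
  assumes a: "a sums A" "\<And>n. 0 \<le> a n" and c: "0 \<le> c" "c < 1" and b: "\<And>n. 0 \<le> b n"
    and rec: "\<And>n. b n = a n + c * (if m \<le> n then b (n - m) else 0)"
  shows "b sums (A / (1 - c))"
proof -
  have "(\<Sum>n<N. b n) \<le> A / (1 - c)" for N
  proof -
    have "(\<Sum>n<N. if m \<le> n then b (n - m) else 0) = (\<Sum>n\<in>{m..<N}. b (n - m))"
      by (rule sum.mono_neutral_cong_right) auto
    also have "\<dots> = (\<Sum>n\<in>{..<N - m}. b n)"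
      by (rule sum.reindex_bij_witness[of _ "\<lambda>n. n + m" "\<lambda>n. n - m"]) auto
    also have "\<dots> \<le> (\<Sum>n<N. b n)"
      by (intro sum_mono2) (auto simp: b)
    finally have "c * (\<Sum>n<N. if m \<le> n then b (n - m) else 0) \<le> c * (\<Sum>n<N. b n)"
      using c by (intro mult_left_mono)
    moreover have "(\<Sum>n<N. a n) \<le> A"
      using a sum_le_suminf[of a "{..<N}"] by (simp add: sums_iff)
    moreover have "(\<Sum>n<N. b n) = (\<Sum>n<N. a n) + c * (\<Sum>n<N. if m \<le> n then b (n - m) else 0)"
      by (subst rec) (simp add: sum.distrib sum_distrib_left)
    ultimately have "(1 - c) * (\<Sum>n<N. b n) \<le> A" by (simp add: algebra_simps)
    thus ?thesis using c by (simp add: field_simps)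
  qed
  from summableI_nonneg_bounded[OF b this] obtain B where B: "b sums B" by blast
  hence "(\<lambda>n. a n + c * (if m \<le> n then b (n - m) else 0)) sums (A + c * B)"
    by (intro sums_add sums_mult a) (simp only: sums_shift_iff)
  hence "b sums (A + c * B)" by (simp only: rec[symmetric])
  hence "B = A + c * B" using B sums_unique2 by blast
  hence "B = A / (1 - c)" using c by (simp add: field_simps)
  thus ?thesis using B by simp
qed

lemma num_partitions_mono:
  assumes "S \<subseteq> T" "0 \<notin> T"
  shows "num_partitions S n \<le> num_partitions T n"
  unfolding num_partitions_def using assms by (intro card_mono finite_partitions) auto

lemma num_partitions_Int_lessThan:
  assumes "n < N"
  shows "num_partitions (S \<inter> {..<N}) n = num_partitions S n"
proof -
  have "m \<le> sum_mset P" if "m \<in># P" for m and P :: "nat multiset"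
    using multi_member_split[OF that] by auto
  hence "{P. set_mset P \<subseteq> S \<inter> {..<N} \<and> sum_mset P = n} = {P. set_mset P \<subseteq> S \<and> sum_mset P = n}"
    using assms by fastforce
  thus ?thesis by (simp add: num_partitions_def)
qed

lemma sums_num_partitions_finite:
  fixes q :: real
  assumes "finite S" "0 \<notin> S" and q: "0 < q" "q < 1"
  shows "(\<lambda>n. real (num_partitions S n) * q ^ n) sums (1 / (\<Prod>m\<in>S. 1 - q ^ m))"
  using assms(1,2)
proof (induction S rule: finite_induct)
  case empty
  have "{P :: nat multiset. set_mset P \<subseteq> {} \<and> sum_mset P = n} = (if n = 0 then {{#}} else {})" for n
    by auto
  hence "(\<lambda>n. real (num_partitions {} n) * q ^ n) = (\<lambda>n. if n = 0 then 1 else 0)"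
    by (auto simp: num_partitions_def)
  thus ?case using sums_single[of 0 "\<lambda>_. 1 :: real"] by simp
next
  case (insert m S)
  have "m > 0" using insert by (cases m) auto
  have "(\<lambda>n. real (num_partitions (insert m S) n) * q ^ n)
      sums (1 / (\<Prod>m\<in>S. 1 - q ^ m) / (1 - q ^ m))"
  proof (rule sums_if_shift_recurrence)
    show "(\<lambda>n. real (num_partitions S n) * q ^ n) sums (1 / (\<Prod>m\<in>S. 1 - q ^ m))"
      using insert by simp
    show "q ^ m < 1" using q \<open>m > 0\<close> by (simp add: power_less_one_iff)
    show "real (num_partitions (insert m S) n) * q ^ n = real (num_partitions S n) * q ^ n
        + q ^ m * (if m \<le> n then real (num_partitions (insert m S) (n - m)) * q ^ (n - m) else 0)"
      for n
      using num_partitions_insert[of m S n] insert \<open>m > 0\<close>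
      by (auto simp: algebra_simps power_add[symmetric])
  qed (use q in auto)
  thus ?case using insert by (simp add: mult.commute)
qed

theorem sums_num_partitions:
  fixes q :: real
  assumes S: "0 \<notin> S" and q: "0 < q" "q < 1"
  shows "(\<lambda>n. real (num_partitions S n) * q ^ n) sums (1 / qprod q S)"
proof -
  define P where "P N = (\<Prod>m<N. if m \<in> S then 1 - q ^ m else 1)" for N
  define p where "p N n = num_partitions (S \<inter> {..<N}) n" for N n
  have "P N = (\<Prod>m\<in>S \<inter> {..<N}. 1 - q ^ m)" for N
    unfolding P_def by (subst Int_commute, subst prod.inter_restrict) auto
  hence sums_p: "(\<lambda>n. real (p N n) * q ^ n) sums (1 / P N)" for N
    using sums_num_partitions_finite[OF _ _ q, of "S \<inter> {..<N}"] S by (simp add: p_def)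
  have lim: "(\<lambda>N. 1 / P N) \<longlonglongrightarrow> 1 / qprod q S"
    unfolding P_def
    by (intro tendsto_divide tendsto_const qprod_LIMSEQ S q) (use qprod_pos[OF q S] in simp)
  have partial_sum_le: "(\<Sum>n<N. real (num_partitions S n) * q ^ n) \<le> 1 / P N" for N
  proof -
    have "(\<Sum>n<N. real (num_partitions S n) * q ^ n) = (\<Sum>n<N. real (p N n) * q ^ n)"
      by (intro sum.cong) (auto simp: p_def num_partitions_Int_lessThan)
    also have "\<dots> \<le> (\<Sum>n. real (p N n) * q ^ n)"
      using sums_p[of N] q by (intro sum_le_suminf) (auto simp: sums_iff)
    finally show ?thesis using sums_p[of N] by (simp add: sums_iff)
  qed
  obtain K where K: "\<And>N. norm (1 / P N) \<le> K"
    using convergent_imp_Bseq[OF convergentI[OF lim]] unfolding Bseq_def by blast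
  have "(\<Sum>n<N. real (num_partitions S n) * q ^ n) \<le> K" for N
    by (rule order_trans[OF partial_sum_le order_trans[OF abs_ge_self K[unfolded real_norm_def]]])
  hence "summable (\<lambda>n. real (num_partitions S n) * q ^ n)"
    by (intro summableI_nonneg_bounded) (use q in simp_all)
  then obtain U where U: "(\<lambda>n. real (num_partitions S n) * q ^ n) sums U" by blast
  have "1 / P N \<le> U" for N
    using S q by (intro sums_le[OF _ sums_p U])
      (auto simp: p_def intro!: mult_right_mono num_partitions_mono)
  hence "(\<lambda>N. 1 / P N) \<longlonglongrightarrow> U"
    using partial_sum_le
    by (intro tendsto_sandwich[OF _ _ U[unfolded sums_def] tendsto_const]) auto
  hence "U = 1 / qprod q S" using lim LIMSEQ_unique by blast
  thus ?thesis using U by simp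
qed

lemma powser_coeffs_eq_0:
  fixes a :: "nat \<Rightarrow> real"
  assumes "\<And>x. 0 < x \<Longrightarrow> x < 1 \<Longrightarrow> (\<lambda>n. a n * x ^ n) sums 0"
  shows "a n = 0"
proof (induction n rule: less_induct)
  case (less n)
  define c where "c k = a (k + n)" for k
  have c: "(\<lambda>k. c k * x ^ k) sums 0" if x: "0 < x" "x < 1" for x
  proof -
    have "(\<lambda>k. a (k + n) * x ^ (k + n)) sums (0 - (\<Sum>i<n. a i * x ^ i))"
      using assms[OF x] by (subst sums_iff_shift) simp
    hence "(\<lambda>k. x ^ n * (c k * x ^ k)) sums (x ^ n * 0)"
      using less by (simp add: c_def power_add mult_ac)
    thus ?thesis using x by (subst (asm) sums_mult_iff) auto
  qed
  have "summable (\<lambda>k. c k * x ^ k)" if "norm x < 1" for x :: real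
  proof -
    from dense[OF that] obtain y where y: "norm x < y" "y < 1" by blast
    hence "summable (\<lambda>k. c k * y ^ k)" using c[of y] norm_ge_zero[of x] by (auto simp: sums_iff)
    thus ?thesis by (rule powser_inside) (use y in auto)
  qed
  hence "((\<lambda>x. \<Sum>k. c k * x ^ k) \<longlongrightarrow> c 0) (at 0)"
    by (intro powser_limit_0[of 1]) auto
  hence "((\<lambda>x. \<Sum>k. c k * x ^ k) \<longlongrightarrow> c 0) (at_right 0)"
    by (rule tendsto_mono[rotated]) (simp add: at_le)
  moreover have "((\<lambda>x. \<Sum>k. c k * x ^ k) \<longlongrightarrow> 0) (at_right 0)"
  proof (rule Lim_transform_eventually[OF tendsto_const])
    show "\<forall>\<^sub>F x in at_right 0. 0 = (\<Sum>k. c k * x ^ k)"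
      using eventually_at_right_less[of 0] eventually_at_right_real[of 0 1] c
      by (auto elim!: eventually_mono simp: sums_iff)
  qed
  ultimately have "c 0 = 0" using tendsto_unique trivial_limit_at_right_real by blast
  thus ?case by (simp add: c_def)
qed

lemma num_partitions_eq_shift:
  assumes "0 \<notin> S" "0 \<notin> T"
    and relation: "\<And>q. 0 < q \<Longrightarrow> q < 1 \<Longrightarrow> 1 / qprod q S = q ^ k * (1 / qprod q T) + q ^ j"
    and "n \<noteq> j" "k \<le> n"
  shows "num_partitions S n = num_partitions T (n - k)"
proof -
  define c where "c n = real (num_partitions S n)
    - ((if k \<le> n then real (num_partitions T (n - k)) else 0) + (if n = j then 1 else 0))" for n
  have "(\<lambda>n. c n * q ^ n) sums 0" if q: "0 < q" "q < 1" for q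
  proof -
    have "(\<lambda>n. q ^ k * (if k \<le> n then real (num_partitions T (n - k)) * q ^ (n - k) else 0))
        sums (q ^ k * (1 / qprod q T))"
      by (intro sums_mult iffD2[OF sums_shift_iff] sums_num_partitions assms q)
    hence "(\<lambda>n. real (num_partitions S n) * q ^ n
          - (q ^ k * (if k \<le> n then real (num_partitions T (n - k)) * q ^ (n - k) else 0)
            + (if n = j then q ^ n else 0)))
        sums (1 / qprod q S - (q ^ k * (1 / qprod q T) + q ^ j))"
      by (intro sums_diff sums_add sums_single sums_num_partitions assms q)
    moreover have "real (num_partitions S n) * q ^ n
          - (q ^ k * (if k \<le> n then real (num_partitions T (n - k)) * q ^ (n - k) else 0)
            + (if n = j then q ^ n else 0)) = c n * q ^ n" for n
      by (auto simp: c_def algebra_simps power_add[symmetric])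
    ultimately show ?thesis using relation[OF q] by simp
  qed
  hence "c n = 0" by (rule powser_coeffs_eq_0)
  thus ?thesis using assms(4,5) by (simp add: c_def)
qed

theorem num_partitions_eq_if_gen_eta:
  fixes R R' :: "int set" and M j k n :: nat
  assumes R: "finite R" "\<forall>r\<in>R. 0 < r \<and> 2 * r < int M"
    and R': "finite R'" "\<forall>r\<in>R'. 0 < r \<and> 2 * r < int M"
    and exponents: "(\<Sum>r\<in>R. gen_eta_exponent (real M) (of_int r)) = real j"
      "(\<Sum>r\<in>R'. gen_eta_exponent (real M) (of_int r)) = real j - real k"
    and relation: "\<And>q. 0 < q \<Longrightarrow> q < 1 \<Longrightarrow>
      1 / (\<Prod>r\<in>R. gen_eta q (real M) (of_int r)) = 1 / (\<Prod>r\<in>R'. gen_eta q (real M) (of_int r)) + 1"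
    and n: "n \<noteq> j" "k \<le> n"
  shows "num_partitions (pm_residue_class R (int M)) n
    = num_partitions (pm_residue_class R' (int M)) (n - k)"
proof (rule num_partitions_eq_shift[where j = j])
  fix q :: real assume q: "0 < q" "q < 1"
  define S T where "S = qprod q (pm_residue_class R (int M))"
    and "T = qprod q (pm_residue_class R' (int M))"
  have "(\<Prod>r\<in>R. gen_eta q (real M) (of_int r)) = q ^ j * S"
    using prod_gen_eta[OF q R(1)] R(2) q by (simp add: exponents S_def powr_realpow)
  moreover have "(\<Prod>r\<in>R'. gen_eta q (real M) (of_int r)) = q ^ j / q ^ k * T"
    using prod_gen_eta[OF q R'(1)] R'(2) q by (simp add: exponents T_def powr_diff powr_realpow)
  ultimately have "1 / (q ^ j * S) = 1 / (q ^ j / q ^ k * T) + 1"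
    using relation[OF q] by simp
  moreover have "1 / S = q ^ j * (1 / (q ^ j * S))" using q by simp
  ultimately have "1 / S = q ^ j * (1 / (q ^ j / q ^ k * T) + 1)" by (simp only:)
  also have "\<dots> = q ^ k * (1 / T) + q ^ j" using q by (simp add: distrib_left)
  finally show "1 / S = q ^ k * (1 / T) + q ^ j" .
qed (use n in \<open>simp_all add: zero_notin_pm_residue_class\<close>)

theorem theorem8p2:
  shows "(let S = pm_residue_class {1, 6, 7, 8, 9, 11, 12, 13, 16, 17, 19, 23} 50;
          T = pm_residue_class {1, 5, 6, 7, 8, 11, 15, 17, 18, 19, 23, 24} 50
      in \<forall>n\<ge>1. num_partitions S n = num_partitions T (n - 1))
    \<and> (let S = pm_residue_class {1, 3, 4, 5, 7, 15, 17, 18, 19, 21, 22, 24} 50;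
          T = pm_residue_class {1, 2, 3, 7, 11, 14, 17, 18, 19, 21, 23, 24} 50
      in \<forall>n\<ge>1. num_partitions S n = num_partitions T (n - 1))
    \<and> (let S = pm_residue_class {1, 3, 4, 5, 7, 9, 12, 13, 15, 16, 21, 22} 50;
          T = pm_residue_class {1, 3, 4, 6, 7, 8, 9, 13, 17, 19, 21, 22} 50
      in \<forall>n. n \<noteq> 5 \<longrightarrow> num_partitions S n = num_partitions T n)
    \<and> (let S = pm_residue_class {2, 3, 5, 9, 11, 12, 13, 14, 15, 16, 21, 23} 50;
          T = pm_residue_class {1, 3, 7, 9, 11, 12, 13, 16, 18, 21, 23, 24} 50
      in \<forall>n\<ge>2. num_partitions S n = num_partitions T (n - 2))
    \<and> (let S = pm_residue_class {2, 5, 6, 8, 9, 11, 13, 14, 15, 17, 19, 23} 50;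
          T = pm_residue_class {2, 3, 4, 9, 11, 13, 14, 17, 19, 21, 22, 23} 50
      in \<forall>n\<ge>2. num_partitions S n = num_partitions T (n - 2))"
proof -
  note transfer = num_partitions_eq_if_gen_eta[where M = 50, simplified]
  note relations = theta_50.reciprocal_relations[OF theta_50_gen_eta]
  note exponent = gen_eta_exponent_def power2_eq_square
  show ?thesis
    unfolding Let_def
  proof (intro conjI allI impI, goal_cases)
    case (1 n) thus ?case
      using transfer[OF _ _ _ _ _ _ relations(1), where n = n and j = 0 and k = 1]
      by (simp add: exponent)
  next
    case (2 n) thus ?case
      using transfer[OF _ _ _ _ _ _ relations(2), where n = n and j = 0 and k = 1]
      by (simp add: exponent)
  next
    case (3 n) thus ?case
      using transfer[OF _ _ _ _ _ _ relations(3), where n = n and j = 5 and k = 0]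
      by (simp add: exponent)
  next
    case (4 n) thus ?case
      using transfer[OF _ _ _ _ _ _ relations(4), where n = n and j = 0 and k = 2]
      by (simp add: exponent)
  next
    case (5 n) thus ?case
      using transfer[OF _ _ _ _ _ _ relations(5), where n = n and j = 0 and k = 2]
      by (simp add: exponent)
  qed
qed

end
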